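(* Consider a purely kinetic Chaplygin system with symmetry group $G$, a $G$-invariant $\mathcal D$-preserving modification $\overline g$ of $g$, and $F=f\circ\pi$ with $f\in C^\infty(Q/G)$. The following conditions are equivalent: (i) the couple $(\overline g_{ai},F=f\circ\pi)$ satisfies condition $(A')$, i.e. on $Q/G$ $$\overline g_{bk}R^k_{ac}+\overline g_{ak}R^k_{bc}-g_{bc}\frac{\partial f}{\partial q^a}-g_{ac}\frac{\partial f}{\partial q^b}+2g_{ab}\frac{\partial f}{\partial q^c}=0\quad\text{for all }a,b,c;$$ (ii) the couple $(\overline g_{ai},F=f\circ\pi)$ satisfies $df\wedge\theta_l=\gamma$, where $$\gamma=\gamma_{bca}\,\dot q^a\,dq^b\wedge dq^c,\qquad \gamma_{bca}=\tfrac16\left(\overline g_{bk}R^k_{ac}-\overline g_{ck}R^k_{ab}+2\overline g_{ak}R^k_{bc}\right).$$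
   Context: Setting: $Q$ is an $n$-dimensional manifold with Riemannian metric $g$, $\mathcal D\subset TQ$ is a distribution of rank $m$, $L(v)=\frac12g(v,v)$. The system $(L,\mathcal D)$ is a (purely kinetic) Chaplygin system: a Lie group $G$ acts freely and properly on $Q$, $\pi:Q\to Q/G$ is the principal bundle, $g$ and $\mathcal D$ are $G$-invariant, and $\mathcal D$ is the horizontal distribution of a principal connection on $\pi$ (so $TQ=\mathcal D\oplus V\pi$, with $V\pi=\ker T\pi$, and $\dim Q/G=m$). Indices $a,b,c,d=1,\dots,m$; $i,j,k=1,\dots,n-m$. Summation convention is used. Frames: $V_i$ are the infinitesimal generators of a basis of the Lie algebra of $G$; $X_a$ are the horizontal lifts of the coordinate fields $\partial/\partial q^a$ on $Q/G$. Set $G_{ab}=g(X_a,X_b)$ (inverse $G^{ab}$), $G_{ai}=g(X_a,V_i)$, $K^b_i=-G^{ab}G_{ai}$, $X_i=V_i+K^b_iX_b$ (so $\{X_i\}$ spans the $g$-orthogonal complement of $\mathcal D$). Write $[X_a,X_b]=R^c_{ab}X_c+R^k_{ab}X_k$, $g_{ab}=G_{ab}$, $\overline g_{ai}=\overline g(X_a,X_i)$. A symmetric $(0,2)$-tensor field $\overline g$ is a $\mathcal D$-preserving modification of $g$ if $\overline g|_{\mathcal D\times\mathcal D}=g|_{\mathcal D\times\mathcal D}$. For $G$-invariant $\overline g$, the functions $g_{ab}$ and $\overline g_{ak}R^k_{bc}$ on $Q$ are $G$-invariant and are regarded as functions on $Q/G$. On $T(Q/G)$, with coordinates $(q^a,\dot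 q^a)$, $\theta_l=g_{ab}\dot q^a dq^b$; $f$ is pulled back to $T(Q/G)$. *)

theory Defs
  imports "HOL-Analysis.Analysis" "HOL-Algebra.Group_Action" "HOL-Library.Function_Algebras"
begin

section \<open>Smooth manifolds\<close>

text \<open>\<open>f\<close> is k times continuously differentiable on \<open>S\<close>, stated through iterated directional
  derivatives; the derivatives are unrestricted ones, so \<open>S\<close> has to be open.\<close>

fun Ck_on :: "nat \<Rightarrow> 'a::euclidean_space set \<Rightarrow> ('a \<Rightarrow> 'b::real_normed_vector) \<Rightarrow> bool" where
  "Ck_on 0 S f \<longleftrightarrow> continuous_on S f"
| "Ck_on (Suc k) S f \<longleftrightarrow>
     (\<forall>x\<in>S. f differentiable (at x)) \<and> (\<forall>v. Ck_on k S (\<lambda>x. frechet_derivative f (at x) v))"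

definition Cinf_on :: "'a::euclidean_space set \<Rightarrow> ('a \<Rightarrow> 'b::real_normed_vector) \<Rightarrow> bool" where
  "Cinf_on S f \<longleftrightarrow> (\<forall>k. Ck_on k S f)"

type_synonym ('p, 'e) chart = "'p set \<times> ('p \<Rightarrow> 'e)"
type_synonym ('p, 'e) atlas = "('p, 'e) chart set"

definition points :: "('p, 'e) atlas \<Rightarrow> 'p set" where
  "points A = (\<Union>(U, \<phi>)\<in>A. U)"

text \<open>A manifold is given by its atlas alone; its topology is the one making the charts
  homeomorphisms onto open sets. The atlas may, but need not, be maximal.\<close>

definition mtop :: "('p, 'e::euclidean_space) atlas \<Rightarrow> 'p topology" where
  "mtop A = topology_generated_by {{p \<in> U. \<phi> p \<in> S} | U \<phi> S. (U, \<phi>) \<in> A \<and> open S}"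

definition smooth_manifold :: "('p, 'e::euclidean_space) atlas \<Rightarrow> bool" where
  "smooth_manifold A \<longleftrightarrow>
     (\<forall>(U, \<phi>)\<in>A. inj_on \<phi> U \<and> open (\<phi> ` U)) \<and>
     (\<forall>(U, \<phi>)\<in>A. \<forall>(V, \<psi>)\<in>A. open (\<phi> ` (U \<inter> V)) \<and>
        Cinf_on (\<phi> ` (U \<inter> V)) (\<psi> \<circ> inv_into U \<phi>)) \<and>
     Hausdorff_space (mtop A) \<and> second_countable (mtop A)"

definition smooth_near :: "('p, 'e::euclidean_space) atlas \<Rightarrow> 'p \<Rightarrow> ('p \<Rightarrow> real) \<Rightarrow> bool" where
  "smooth_near A p f \<longleftrightarrow>
     (\<forall>(U, \<phi>)\<in>A. p \<in> U \<longrightarrow>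
        (\<exists>S. open S \<and> \<phi> p \<in> S \<and> S \<subseteq> \<phi> ` U \<and> Cinf_on S (f \<circ> inv_into U \<phi>)))"

definition smooth_fun_on :: "('p, 'e::euclidean_space) atlas \<Rightarrow> 'p set \<Rightarrow> ('p \<Rightarrow> real) \<Rightarrow> bool" where
  "smooth_fun_on A W f \<longleftrightarrow> (\<forall>p\<in>W. smooth_near A p f)"

definition smooth_map ::
  "('p, 'e::euclidean_space) atlas \<Rightarrow> ('r, 'd::euclidean_space) atlas \<Rightarrow> ('p \<Rightarrow> 'r) \<Rightarrow> bool" where
  "smooth_map A B F \<longleftrightarrow>
     (\<forall>p\<in>points A. F p \<in> points B \<and>
       (\<forall>(U, \<phi>)\<in>A. \<forall>(V, \<psi>)\<in>B. p \<in> U \<longrightarrow> F p \<in> V \<longrightarrow>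
          (\<exists>S. open S \<and> \<phi> p \<in> S \<and> S \<subseteq> \<phi> ` {r \<in> U. F r \<in> V} \<and>
               Cinf_on S (\<psi> \<circ> F \<circ> inv_into U \<phi>))))"

definition prod_atlas :: "('p, 'e) atlas \<Rightarrow> ('r, 'd) atlas \<Rightarrow> ('p \<times> 'r, 'e \<times> 'd) atlas" where
  "prod_atlas A B = {(U \<times> V, map_prod \<phi> \<psi>) | U \<phi> V \<psi>. (U, \<phi>) \<in> A \<and> (V, \<psi>) \<in> B}"


section \<open>Tangent vectors, tensors and forms\<close>

text \<open>Tangent vectors at \<open>p\<close> are the derivations of germs of smooth functions given by directional
  derivatives in a chart (the linear combinations of the coordinate vectors at \<open>p\<close>). They are
  extended by \<open>0\<close> to functions that are not smooth near \<open>p\<close>, so that equality of tangent vectors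
  is equality of functions.\<close>

type_synonym 'p tvec = "('p \<Rightarrow> real) \<Rightarrow> real"
type_synonym 'p vfield = "'p \<Rightarrow> 'p tvec"
type_synonym 'p tensor2 = "'p \<Rightarrow> 'p tvec \<Rightarrow> 'p tvec \<Rightarrow> real"
type_synonym 'p form1 = "'p \<Rightarrow> 'p tvec \<Rightarrow> real"
type_synonym 'p form2 = "'p \<Rightarrow> 'p tvec \<Rightarrow> 'p tvec \<Rightarrow> real"

definition fscale :: "real \<Rightarrow> ('x \<Rightarrow> real) \<Rightarrow> 'x \<Rightarrow> real" where
  "fscale c v = (\<lambda>f. c * v f)"

global_interpretation fn: vector_space fscale
  by standard (auto simp: fscale_def algebra_simps fun_eq_iff)

text \<open>For a chart \<open>\<kappa> = (U, \<phi>)\<close> with values in \<open>real^'m\<close> and \<open>e = axis a 1\<close>, this is the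
  coordinate vector \<open>\<partial>/\<partial>q\<^sup>a\<close> at \<open>p\<close>.\<close>

definition coord_deriv ::
  "('p, 'e::euclidean_space) atlas \<Rightarrow> ('p, 'e) chart \<Rightarrow> 'p \<Rightarrow> 'e \<Rightarrow> 'p tvec" where
  "coord_deriv A \<kappa> p e = (\<lambda>f. if smooth_near A p f
      then frechet_derivative (f \<circ> inv_into (fst \<kappa>) (snd \<kappa>)) (at (snd \<kappa> p)) e else 0)"

definition tangent_space :: "('p, 'e::euclidean_space) atlas \<Rightarrow> 'p \<Rightarrow> 'p tvec set" where
  "tangent_space A p = {coord_deriv A \<kappa> p e | \<kappa> e. \<kappa> \<in> A \<and> p \<in> fst \<kappa>}"

text \<open>The tangent map of \<open>F\<close> at \<open>p\<close>; \<open>B\<close> is the atlas of the target manifold.\<close>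

definition pushforward ::
  "('r, 'd::euclidean_space) atlas \<Rightarrow> ('p \<Rightarrow> 'r) \<Rightarrow> 'p \<Rightarrow> 'p tvec \<Rightarrow> 'r tvec" where
  "pushforward B F p v = (\<lambda>h. if smooth_near B (F p) h then v (h \<circ> F) else 0)"

definition smooth_vfield_on :: "('p, 'e::euclidean_space) atlas \<Rightarrow> 'p set \<Rightarrow> 'p vfield \<Rightarrow> bool" where
  "smooth_vfield_on A W X \<longleftrightarrow>
     (\<forall>p\<in>W. X p \<in> tangent_space A p \<and>
        (\<forall>f. smooth_near A p f \<longrightarrow> smooth_near A p (\<lambda>r. X r f)))"

definition lie_bracket ::
  "('p, 'e::euclidean_space) atlas \<Rightarrow> 'p vfield \<Rightarrow> 'p vfield \<Rightarrow> 'p vfield" where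
  "lie_bracket A X Y p = (\<lambda>f. if smooth_near A p f
      then X p (\<lambda>r. Y r f) - Y p (\<lambda>r. X r f) else 0)"

definition symmetric_tensor :: "('p, 'e::euclidean_space) atlas \<Rightarrow> 'p tensor2 \<Rightarrow> bool" where
  "symmetric_tensor A g \<longleftrightarrow>
     (\<forall>p\<in>points A. \<forall>u\<in>tangent_space A p. \<forall>v\<in>tangent_space A p.
        g p u v = g p v u \<and>
        (\<forall>w\<in>tangent_space A p. g p (u + w) v = g p u v + g p w v) \<and>
        (\<forall>c. g p (fscale c u) v = c * g p u v)) \<and>
     (\<forall>W X Y. openin (mtop A) W \<and> smooth_vfield_on A W X \<and> smooth_vfield_on A W Y \<longrightarrow>
        smooth_fun_on A W (\<lambda>p. g p (X p) (Y p)))"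

definition riemannian_metric :: "('p, 'e::euclidean_space) atlas \<Rightarrow> 'p tensor2 \<Rightarrow> bool" where
  "riemannian_metric A g \<longleftrightarrow> symmetric_tensor A g \<and>
     (\<forall>p\<in>points A. \<forall>v\<in>tangent_space A p. v \<noteq> 0 \<longrightarrow> g p v v > 0)"

text \<open>The rank is \<open>CARD('m)\<close>, the number of members of a local frame.\<close>

definition distribution_of_rank ::
  "'m::finite itself \<Rightarrow> ('p, 'e::euclidean_space) atlas \<Rightarrow> ('p \<Rightarrow> 'p tvec set) \<Rightarrow> bool" where
  "distribution_of_rank T A D \<longleftrightarrow>
     (\<forall>p\<in>points A. \<exists>W. \<exists>X :: 'm \<Rightarrow> 'p vfield. openin (mtop A) W \<and> p \<in> W \<and>
        (\<forall>a. smooth_vfield_on A W (X a)) \<and>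
        (\<forall>r\<in>W. inj (\<lambda>a. X a r) \<and> fn.independent (range (\<lambda>a. X a r)) \<and>
                D r = fn.span (range (\<lambda>a. X a r))))"

text \<open>The tangent bundle: its points are pairs \<open>(p, v)\<close>, its charts the induced coordinates
  \<open>(q\<^sup>a, v\<^sup>a)\<close> with \<open>v\<^sup>a = v(q\<^sup>a)\<close>.\<close>

definition tangent_atlas ::
  "('p, real^'m::finite) atlas \<Rightarrow> ('p \<times> 'p tvec, (real^'m) \<times> (real^'m)) atlas" where
  "tangent_atlas A = {({(p, v). p \<in> U \<and> v \<in> tangent_space A p},
       \<lambda>(p, v). (\<phi> p, \<chi> a. v (\<lambda>r. \<phi> r $ a))) | U \<phi>. (U, \<phi>) \<in> A}"

definition differential :: "('p \<Rightarrow> real) \<Rightarrow> 'p form1" where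
  "differential h = (\<lambda>p w. w h)"

definition wedge :: "'p form1 \<Rightarrow> 'p form1 \<Rightarrow> 'p form2" where
  "wedge \<alpha> \<beta> = (\<lambda>p u v. \<alpha> p u * \<beta> p v - \<alpha> p v * \<beta> p u)"


section \<open>Lie groups and actions\<close>

definition lie_group :: "'h monoid \<Rightarrow> ('h, 'e::euclidean_space) atlas \<Rightarrow> bool" where
  "lie_group G A \<longleftrightarrow> group G \<and> smooth_manifold A \<and> carrier G = points A \<and>
     smooth_map (prod_atlas A A) A (\<lambda>(x, y). x \<otimes>\<^bsub>G\<^esub> y) \<and>
     smooth_map A A (\<lambda>x. inv\<^bsub>G\<^esub> x)"

definition smooth_action ::
  "'h monoid \<Rightarrow> ('h, 'd::euclidean_space) atlas \<Rightarrow> ('p, 'e::euclidean_space) atlas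
     \<Rightarrow> ('h \<Rightarrow> 'p \<Rightarrow> 'p) \<Rightarrow> bool" where
  "smooth_action G AG A act \<longleftrightarrow> group_action G (points A) act \<and>
     smooth_map (prod_atlas AG A) A (\<lambda>(h, q). act h q)"

definition free_action :: "'h monoid \<Rightarrow> 'p set \<Rightarrow> ('h \<Rightarrow> 'p \<Rightarrow> 'p) \<Rightarrow> bool" where
  "free_action G E act \<longleftrightarrow> (\<forall>q\<in>E. stabilizer G act q = {\<one>\<^bsub>G\<^esub>})"

definition proper_action ::
  "('h, 'd::euclidean_space) atlas \<Rightarrow> ('p, 'e::euclidean_space) atlas
     \<Rightarrow> ('h \<Rightarrow> 'p \<Rightarrow> 'p) \<Rightarrow> bool" where
  "proper_action AG A act \<longleftrightarrow>
     proper_map (prod_topology (mtop AG) (mtop A)) (prod_topology (mtop A) (mtop A))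
       (\<lambda>(h, q). (act h q, q))"

text \<open>The smooth structure of the orbit space: the (unique) one for which the projection onto
  orbits is a smooth submersion.\<close>

definition orbit_manifold ::
  "'h monoid \<Rightarrow> ('p, 'e::euclidean_space) atlas \<Rightarrow> ('h \<Rightarrow> 'p \<Rightarrow> 'p)
     \<Rightarrow> ('p set, 'd::euclidean_space) atlas \<Rightarrow> bool" where
  "orbit_manifold G A act B \<longleftrightarrow>
     smooth_manifold B \<and> points B = orbits G (points A) act \<and>
     smooth_map A B (orbit G act) \<and>
     (\<forall>q\<in>points A.
        pushforward B (orbit G act) q ` tangent_space A q = tangent_space B (orbit G act q))"

definition invariant_tensor ::
  "'h monoid \<Rightarrow> ('p, 'e::euclidean_space) atlas \<Rightarrow> ('h \<Rightarrow> 'p \<Rightarrow> 'p) \<Rightarrow> 'p tensor2 \<Rightarrow> bool" where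
  "invariant_tensor G A act g \<longleftrightarrow>
     (\<forall>h\<in>carrier G. \<forall>q\<in>points A. \<forall>u\<in>tangent_space A q. \<forall>v\<in>tangent_space A q.
        g (act h q) (pushforward A (act h) q u) (pushforward A (act h) q v) = g q u v)"

definition invariant_distribution ::
  "'h monoid \<Rightarrow> ('p, 'e::euclidean_space) atlas \<Rightarrow> ('h \<Rightarrow> 'p \<Rightarrow> 'p)
     \<Rightarrow> ('p \<Rightarrow> 'p tvec set) \<Rightarrow> bool" where
  "invariant_distribution G A act D \<longleftrightarrow>
     (\<forall>h\<in>carrier G. \<forall>q\<in>points A. D (act h q) = pushforward A (act h) q ` D q)"


section \<open>Purely kinetic Chaplygin systems\<close>

text \<open>The Lagrangian \<open>L(v) = g(v,v)/2\<close> is represented by the metric. The index types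
  \<open>'n\<close>, \<open>'m\<close>, \<open>'k\<close> have \<open>dim Q\<close>, \<open>dim Q/G = rank D\<close> and \<open>dim G = dim Q - rank D\<close> elements.\<close>

record ('q, 'n::finite, 'h, 'k::finite, 'm::finite) chaplygin =
  Qatlas :: "('q, real^'n) atlas"
  Ggroup :: "'h monoid"
  Gatlas :: "('h, real^'k) atlas"
  Gact :: "'h \<Rightarrow> 'q \<Rightarrow> 'q"
  Batlas :: "('q set, real^'m) atlas"
  metric_g :: "'q tensor2"
  distr :: "'q \<Rightarrow> 'q tvec set"

definition bproj ::
  "('q, 'n::finite, 'h, 'k::finite, 'm::finite) chaplygin \<Rightarrow> 'q \<Rightarrow> 'q set" where
  "bproj S = orbit (Ggroup S) (Gact S)"

definition vertical ::
  "('q, 'n::finite, 'h, 'k::finite, 'm::finite) chaplygin \<Rightarrow> 'q \<Rightarrow> 'q tvec set" where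
  "vertical S q = {v \<in> tangent_space (Qatlas S) q. pushforward (Batlas S) (bproj S) q v = 0}"

definition chaplygin_system ::
  "('q, 'n::finite, 'h, 'k::finite, 'm::finite) chaplygin \<Rightarrow> bool" where
  "chaplygin_system S \<longleftrightarrow>
     smooth_manifold (Qatlas S) \<and>
     riemannian_metric (Qatlas S) (metric_g S) \<and>
     distribution_of_rank TYPE('m) (Qatlas S) (distr S) \<and>
     lie_group (Ggroup S) (Gatlas S) \<and>
     smooth_action (Ggroup S) (Gatlas S) (Qatlas S) (Gact S) \<and>
     free_action (Ggroup S) (points (Qatlas S)) (Gact S) \<and>
     proper_action (Gatlas S) (Qatlas S) (Gact S) \<and>
     orbit_manifold (Ggroup S) (Qatlas S) (Gact S) (Batlas S) \<and>
     invariant_tensor (Ggroup S) (Qatlas S) (Gact S) (metric_g S) \<and>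
     invariant_distribution (Ggroup S) (Qatlas S) (Gact S) (distr S) \<and>
     (\<forall>q\<in>points (Qatlas S). distr S q \<inter> vertical S q = {0} \<and>
        {u + v | u v. u \<in> distr S q \<and> v \<in> vertical S q} = tangent_space (Qatlas S) q)"

definition D_preserving_modification ::
  "('q, 'n::finite, 'h, 'k::finite, 'm::finite) chaplygin \<Rightarrow> 'q tensor2 \<Rightarrow> bool" where
  "D_preserving_modification S gbar \<longleftrightarrow> symmetric_tensor (Qatlas S) gbar \<and>
     (\<forall>q\<in>points (Qatlas S). \<forall>u\<in>distr S q. \<forall>v\<in>distr S q. gbar q u v = metric_g S q u v)"

definition lie_algebra_basis ::
  "('q, 'n::finite, 'h, 'k::finite, 'm::finite) chaplygin \<Rightarrow> ('k \<Rightarrow> 'h tvec) \<Rightarrow> bool" where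
  "lie_algebra_basis S \<xi> \<longleftrightarrow> inj \<xi> \<and> fn.independent (range \<xi>) \<and>
     fn.span (range \<xi>) = tangent_space (Gatlas S) \<one>\<^bsub>Ggroup S\<^esub>"

text \<open>In the following frames \<open>\<xi>\<close> is the chosen basis of the Lie algebra and \<open>\<kappa>\<close> a chart
  \<open>(q\<^sup>a)\<close> of \<open>Q/G\<close>; the fields \<open>Xh\<close> (\<open>X\<^sub>a\<close>) and \<open>Xp\<close> (\<open>X\<^sub>i\<close>) are meaningful on the preimage of the
  chart domain only.\<close>

definition inf_gen ::
  "('q, 'n::finite, 'h, 'k::finite, 'm::finite) chaplygin \<Rightarrow> ('k \<Rightarrow> 'h tvec) \<Rightarrow> 'k \<Rightarrow> 'q vfield" where
  "inf_gen S \<xi> i q = pushforward (Qatlas S) (\<lambda>h. Gact S h q) \<one>\<^bsub>Ggroup S\<^esub> (\<xi> i)"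

definition horizontal_lift ::
  "('q, 'n::finite, 'h, 'k::finite, 'm::finite) chaplygin \<Rightarrow> 'q \<Rightarrow> 'q set tvec \<Rightarrow> 'q tvec" where
  "horizontal_lift S q w = (THE v. v \<in> distr S q \<and> pushforward (Batlas S) (bproj S) q v = w)"

definition coord_field ::
  "('q, 'n::finite, 'h, 'k::finite, 'm::finite) chaplygin \<Rightarrow> ('q set, real^'m) chart
     \<Rightarrow> 'm \<Rightarrow> 'q set vfield" where
  "coord_field S \<kappa> a p = coord_deriv (Batlas S) \<kappa> p (axis a 1)"

definition Xh ::
  "('q, 'n::finite, 'h, 'k::finite, 'm::finite) chaplygin \<Rightarrow> ('q set, real^'m) chart
     \<Rightarrow> 'm \<Rightarrow> 'q vfield" where
  "Xh S \<kappa> a q = horizontal_lift S q (coord_field S \<kappa> a (bproj S q))"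

definition Gmat ::
  "('q, 'n::finite, 'h, 'k::finite, 'm::finite) chaplygin \<Rightarrow> ('q set, real^'m) chart
     \<Rightarrow> 'q \<Rightarrow> real^'m^'m" where
  "Gmat S \<kappa> q = (\<chi> a b. metric_g S q (Xh S \<kappa> a q) (Xh S \<kappa> b q))"

definition Kcoeff ::
  "('q, 'n::finite, 'h, 'k::finite, 'm::finite) chaplygin \<Rightarrow> ('k \<Rightarrow> 'h tvec)
     \<Rightarrow> ('q set, real^'m) chart \<Rightarrow> 'm \<Rightarrow> 'k \<Rightarrow> 'q \<Rightarrow> real" where
  "Kcoeff S \<xi> \<kappa> b i q =
     - (\<Sum>a\<in>UNIV. matrix_inv (Gmat S \<kappa> q) $ a $ b * metric_g S q (Xh S \<kappa> a q) (inf_gen S \<xi> i q))"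

definition Xp ::
  "('q, 'n::finite, 'h, 'k::finite, 'm::finite) chaplygin \<Rightarrow> ('k \<Rightarrow> 'h tvec)
     \<Rightarrow> ('q set, real^'m) chart \<Rightarrow> 'k \<Rightarrow> 'q vfield" where
  "Xp S \<xi> \<kappa> i q =
     inf_gen S \<xi> i q + (\<Sum>b\<in>UNIV. fscale (Kcoeff S \<xi> \<kappa> b i q) (Xh S \<kappa> b q))"

text \<open>\<open>[X\<^sub>a, X\<^sub>b] = R\<^sup>d\<^sub>a\<^sub>b X\<^sub>d + R\<^sup>k\<^sub>a\<^sub>b X\<^sub>k\<close>, with \<open>Rh \<kappa> d a b q\<close> for \<open>R\<^sup>d\<^sub>a\<^sub>b(q)\<close> and \<open>R \<kappa> k a b q\<close>
  for \<open>R\<^sup>k\<^sub>a\<^sub>b(q)\<close>, in each chart \<open>\<kappa>\<close> of \<open>Q/G\<close>.\<close>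

definition bracket_coefficients ::
  "('q, 'n::finite, 'h, 'k::finite, 'm::finite) chaplygin \<Rightarrow> ('k \<Rightarrow> 'h tvec)
     \<Rightarrow> (('q set, real^'m) chart \<Rightarrow> 'm \<Rightarrow> 'm \<Rightarrow> 'm \<Rightarrow> 'q \<Rightarrow> real)
     \<Rightarrow> (('q set, real^'m) chart \<Rightarrow> 'k \<Rightarrow> 'm \<Rightarrow> 'm \<Rightarrow> 'q \<Rightarrow> real) \<Rightarrow> bool" where
  "bracket_coefficients S \<xi> Rh R \<longleftrightarrow>
     (\<forall>\<kappa>\<in>Batlas S. \<forall>q\<in>points (Qatlas S). bproj S q \<in> fst \<kappa> \<longrightarrow>
        (\<forall>a b. lie_bracket (Qatlas S) (Xh S \<kappa> a) (Xh S \<kappa> b) q =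
           (\<Sum>d\<in>UNIV. fscale (Rh \<kappa> d a b q) (Xh S \<kappa> d q)) +
           (\<Sum>k\<in>UNIV. fscale (R \<kappa> k a b q) (Xp S \<xi> \<kappa> k q))))"

text \<open>The function on \<open>Q/G\<close> induced by a \<open>G\<close>-invariant function on \<open>Q\<close>; points of \<open>Q/G\<close> are
  orbits, so this evaluates at a representative.\<close>

definition descend :: "('q \<Rightarrow> real) \<Rightarrow> 'q set \<Rightarrow> real" where
  "descend F p = F (SOME q. q \<in> p)"

definition g_base ::
  "('q, 'n::finite, 'h, 'k::finite, 'm::finite) chaplygin \<Rightarrow> ('q set, real^'m) chart
     \<Rightarrow> 'm \<Rightarrow> 'm \<Rightarrow> 'q set \<Rightarrow> real" where
  "g_base S \<kappa> a b = descend (\<lambda>q. Gmat S \<kappa> q $ a $ b)"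

text \<open>\<open>gR S gbar \<xi> R \<kappa> a b c\<close> is the function \<open>gbar\<^sub>a\<^sub>k R\<^sup>k\<^sub>b\<^sub>c\<close> on \<open>Q/G\<close>,
  where \<open>gbar\<^sub>a\<^sub>k = gbar(X\<^sub>a, X\<^sub>k)\<close>.\<close>

definition gR ::
  "('q, 'n::finite, 'h, 'k::finite, 'm::finite) chaplygin \<Rightarrow> 'q tensor2 \<Rightarrow> ('k \<Rightarrow> 'h tvec)
     \<Rightarrow> (('q set, real^'m) chart \<Rightarrow> 'k \<Rightarrow> 'm \<Rightarrow> 'm \<Rightarrow> 'q \<Rightarrow> real)
     \<Rightarrow> ('q set, real^'m) chart \<Rightarrow> 'm \<Rightarrow> 'm \<Rightarrow> 'm \<Rightarrow> 'q set \<Rightarrow> real" where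
  "gR S gbar \<xi> R \<kappa> a b c =
     descend (\<lambda>q. \<Sum>k\<in>UNIV. gbar q (Xh S \<kappa> a q) (Xp S \<xi> \<kappa> k q) * R \<kappa> k b c q)"

definition condition_A' ::
  "('q, 'n::finite, 'h, 'k::finite, 'm::finite) chaplygin \<Rightarrow> 'q tensor2 \<Rightarrow> ('k \<Rightarrow> 'h tvec)
     \<Rightarrow> (('q set, real^'m) chart \<Rightarrow> 'k \<Rightarrow> 'm \<Rightarrow> 'm \<Rightarrow> 'q \<Rightarrow> real) \<Rightarrow> ('q set \<Rightarrow> real) \<Rightarrow> bool" where
  "condition_A' S gbar \<xi> R f \<longleftrightarrow>
     (\<forall>\<kappa>\<in>Batlas S. \<forall>p\<in>fst \<kappa>. \<forall>a b c.
        gR S gbar \<xi> R \<kappa> b a c p + gR S gbar \<xi> R \<kappa> a b c p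
        - g_base S \<kappa> b c p * coord_field S \<kappa> a p f
        - g_base S \<kappa> a c p * coord_field S \<kappa> b p f
        + 2 * g_base S \<kappa> a b p * coord_field S \<kappa> c p f = 0)"

text \<open>Forms on \<open>T(Q/G)\<close>, whose points are pairs \<open>z = (p, v)\<close>; \<open>dq \<kappa> a\<close> is the differential of
  the coordinate \<open>q\<^sup>a\<close> pulled back to \<open>T(Q/G)\<close>.\<close>

definition qdot :: "('b, real^'m::finite) chart \<Rightarrow> 'm \<Rightarrow> 'b \<times> 'b tvec \<Rightarrow> real" where
  "qdot \<kappa> a z = snd z (\<lambda>r. snd \<kappa> r $ a)"

definition dq :: "('b, real^'m::finite) chart \<Rightarrow> 'm \<Rightarrow> ('b \<times> 'b tvec) form1" where
  "dq \<kappa> a = differential (\<lambda>z. snd \<kappa> (fst z) $ a)"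

definition theta_l ::
  "('q, 'n::finite, 'h, 'k::finite, 'm::finite) chaplygin \<Rightarrow> ('q set, real^'m) chart
     \<Rightarrow> ('q set \<times> 'q set tvec) form1" where
  "theta_l S \<kappa> = (\<lambda>z w. \<Sum>a\<in>UNIV. \<Sum>b\<in>UNIV. g_base S \<kappa> a b (fst z) * qdot \<kappa> a z * dq \<kappa> b z w)"

definition gamma_coeff ::
  "('q, 'n::finite, 'h, 'k::finite, 'm::finite) chaplygin \<Rightarrow> 'q tensor2 \<Rightarrow> ('k \<Rightarrow> 'h tvec)
     \<Rightarrow> (('q set, real^'m) chart \<Rightarrow> 'k \<Rightarrow> 'm \<Rightarrow> 'm \<Rightarrow> 'q \<Rightarrow> real)
     \<Rightarrow> ('q set, real^'m) chart \<Rightarrow> 'm \<Rightarrow> 'm \<Rightarrow> 'm \<Rightarrow> 'q set \<Rightarrow> real" where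
  "gamma_coeff S gbar \<xi> R \<kappa> b c a p =
     1 / 6 * (gR S gbar \<xi> R \<kappa> b a c p - gR S gbar \<xi> R \<kappa> c a b p + 2 * gR S gbar \<xi> R \<kappa> a b c p)"

definition gamma_form ::
  "('q, 'n::finite, 'h, 'k::finite, 'm::finite) chaplygin \<Rightarrow> 'q tensor2 \<Rightarrow> ('k \<Rightarrow> 'h tvec)
     \<Rightarrow> (('q set, real^'m) chart \<Rightarrow> 'k \<Rightarrow> 'm \<Rightarrow> 'm \<Rightarrow> 'q \<Rightarrow> real)
     \<Rightarrow> ('q set, real^'m) chart \<Rightarrow> ('q set \<times> 'q set tvec) form2" where
  "gamma_form S gbar \<xi> R \<kappa> = (\<lambda>z u v. \<Sum>a\<in>UNIV. \<Sum>b\<in>UNIV. \<Sum>c\<in>UNIV.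
     gamma_coeff S gbar \<xi> R \<kappa> b c a (fst z) * qdot \<kappa> a z * wedge (dq \<kappa> b) (dq \<kappa> c) z u v)"

definition condition_gamma ::
  "('q, 'n::finite, 'h, 'k::finite, 'm::finite) chaplygin \<Rightarrow> 'q tensor2 \<Rightarrow> ('k \<Rightarrow> 'h tvec)
     \<Rightarrow> (('q set, real^'m) chart \<Rightarrow> 'k \<Rightarrow> 'm \<Rightarrow> 'm \<Rightarrow> 'q \<Rightarrow> real) \<Rightarrow> ('q set \<Rightarrow> real) \<Rightarrow> bool" where
  "condition_gamma S gbar \<xi> R f \<longleftrightarrow>
     (\<forall>\<kappa>\<in>Batlas S. \<forall>z\<in>points (tangent_atlas (Batlas S)). fst z \<in> fst \<kappa> \<longrightarrow>
        (\<forall>u\<in>tangent_space (tangent_atlas (Batlas S)) z.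
         \<forall>v\<in>tangent_space (tangent_atlas (Batlas S)) z.
           wedge (differential (f \<circ> fst)) (theta_l S \<kappa>) z u v = gamma_form S gbar \<xi> R \<kappa> z u v))"

end

theory Submission
  imports Defs
begin

text \<open>Write \<open>T\<^sub>a\<^sub>b\<^sub>c\<close> for \<open>gbar\<^sub>a\<^sub>k R\<^sup>k\<^sub>b\<^sub>c\<close>. Since the \<open>X\<^sub>k\<close> are orthogonal to the distribution,
  \<open>R\<^sup>k\<^sub>b\<^sub>c X\<^sub>k\<close> is the orthogonal part of \<open>[X\<^sub>b, X\<^sub>c]\<close>, so \<open>T\<close> is skew in its last two indices.
  Both sides of \<open>df \<and> \<theta>\<^sub>l = \<gamma>\<close> are semibasic and linear in the velocities; as every value of the
  velocities and of the \<open>dq\<^sup>b\<close> is attained, this equation means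
  \<open>T\<^sub>b\<^sub>a\<^sub>c - T\<^sub>c\<^sub>a\<^sub>b + 2 T\<^sub>a\<^sub>b\<^sub>c = 3 (g\<^sub>a\<^sub>c f\<^sub>b - g\<^sub>a\<^sub>b f\<^sub>c)\<close> for all \<open>a\<close>, \<open>b\<close>, \<open>c\<close>.
  This is condition (A') skew-symmetrised in \<open>b\<close>, \<open>c\<close>; symmetrising it in \<open>a\<close>, \<open>b\<close>
  gives (A') back.\<close>

section \<open>Calculus of \<open>Ck_on\<close>\<close>

text \<open>Chart expressions contain \<open>inv_into\<close>, which is arbitrary outside the chart
  image. Functions to be compared therefore agree only on an open set, and derivatives have to be
  transferred from there.\<close>

lemma frechet_derivative_cong_open:
  assumes "open S" "x \<in> S" "\<And>y. y \<in> S \<Longrightarrow> f y = g y" "f differentiable (at x)"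
  shows "g differentiable (at x)" "frechet_derivative g (at x) = frechet_derivative f (at x)"
proof -
  have "(f has_derivative frechet_derivative f (at x)) (at x)"
    using assms(4) frechet_derivative_works by blast
  then have *: "(g has_derivative frechet_derivative f (at x)) (at x)"
    by (rule has_derivative_transform_within_open) (use assms in auto)
  then show "g differentiable (at x)"
    unfolding differentiable_def by blast
  show "frechet_derivative g (at x) = frechet_derivative f (at x)"
    using frechet_derivative_at[OF *] by simp
qed

lemma Ck_on_cong:
  assumes "open S" "\<And>x. x \<in> S \<Longrightarrow> f x = g x" "Ck_on k S f"
  shows "Ck_on k S g"
  using assms(2,3)
proof (induction k arbitrary: f g)
  case 0
  then show ?case by (simp cong: continuous_on_cong)
next
  case (Suc k)
  have d: "f differentiable (at x)" if "x \<in> S" for x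
    using Suc.prems(2) that by simp
  note fr = frechet_derivative_cong_open[OF assms(1) _ Suc.prems(1) d]
  show ?case
    using Suc.IH[of "\<lambda>x. frechet_derivative f (at x) v" "\<lambda>x. frechet_derivative g (at x) v" for v]
      Suc.prems(2) fr by simp
qed

lemma Cinf_on_cong:
  assumes "open S" "\<And>x. x \<in> S \<Longrightarrow> f x = g x" "Cinf_on S f"
  shows "Cinf_on S g"
  using assms Ck_on_cong unfolding Cinf_on_def by blast

lemma Ck_on_subset: "Ck_on k S f \<Longrightarrow> T \<subseteq> S \<Longrightarrow> Ck_on k T f"
proof (induction k arbitrary: f)
  case 0
  then show ?case using continuous_on_subset by auto
next
  case (Suc k)
  then show ?case by auto
qed

lemma Cinf_on_subset: "Cinf_on S f \<Longrightarrow> T \<subseteq> S \<Longrightarrow> Cinf_on T f"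
  using Ck_on_subset unfolding Cinf_on_def by blast

lemma Cinf_on_differentiable: "Cinf_on S f \<Longrightarrow> x \<in> S \<Longrightarrow> f differentiable (at x)"
  unfolding Cinf_on_def by (metis Ck_on.simps(2))

lemma Cinf_on_continuous: "Cinf_on S f \<Longrightarrow> continuous_on S f"
  unfolding Cinf_on_def by (metis Ck_on.simps(1))

text \<open>The recursion speaks only of derivatives, so lowering the order takes an induction, with
  differentiability giving continuity at the bottom. The product rule needs this for its
  undifferentiated factors, the chain rule for the inner map.\<close>

lemma Ck_on_Suc_imp: "Ck_on (Suc k) S f \<Longrightarrow> Ck_on k S f"
proof (induction k arbitrary: f)
  case 0
  then show ?case
    by (simp add: differentiable_imp_continuous_on differentiable_on_def differentiable_at_withinI)
next
  case (Suc k)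
  from Suc.prems have "\<forall>x\<in>S. f differentiable (at x)"
    and "\<And>v. Ck_on (Suc k) S (\<lambda>x. frechet_derivative f (at x) v)" by auto
  then show ?case using Suc.IH by auto
qed

text \<open>By uniqueness of derivatives an explicit \<open>D\<close> may replace
  \<open>frechet_derivative\<close>, which makes the usual rules for sums, products and compositions
  applicable.\<close>

lemma Ck_on_SucI:
  assumes "open S" "\<And>x. x \<in> S \<Longrightarrow> (f has_derivative D x) (at x)"
    "\<And>v. Ck_on k S (\<lambda>x. D x v)"
  shows "Ck_on (Suc k) S f"
proof -
  have "f differentiable (at x)" if "x \<in> S" for x
    using assms(2)[OF that] unfolding differentiable_def by blast
  moreover have "Ck_on k S (\<lambda>x. frechet_derivative f (at x) v)" for v
  proof (rule Ck_on_cong[OF assms(1) _ assms(3)[of v]])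
    fix x assume "x \<in> S"
    then show "D x v = frechet_derivative f (at x) v"
      using frechet_derivative_at[OF assms(2)] by metis
  qed
  ultimately show ?thesis by simp
qed

lemma Ck_on_SucD:
  assumes "Ck_on (Suc k) S f"
  shows "x \<in> S \<Longrightarrow> (f has_derivative frechet_derivative f (at x)) (at x)"
    and "Ck_on k S (\<lambda>x. frechet_derivative f (at x) v)"
  using assms frechet_derivative_works by auto

lemma Ck_on_const: "open S \<Longrightarrow> Ck_on k S (\<lambda>x. c)"
proof (induction k arbitrary: c)
  case (Suc k)
  then show ?case by (intro Ck_on_SucI[where D = "\<lambda>x v. 0"]) auto
qed auto

lemma Ck_on_bounded_linear_comp:
  assumes "bounded_linear L" "open S"
  shows "Ck_on k S f \<Longrightarrow> Ck_on k S (\<lambda>x. L (f x))"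
proof (induction k arbitrary: f)
  case 0
  then show ?case using bounded_linear.continuous_on[OF assms(1)] by simp
next
  case (Suc k)
  show ?case
    by (rule Ck_on_SucI[OF assms(2)
          bounded_linear.has_derivative[OF assms(1) Ck_on_SucD(1)[OF Suc.prems]]])
      (use Suc.IH Ck_on_SucD(2)[OF Suc.prems] in auto)
qed

lemma Cinf_on_bounded_linear:
  assumes "bounded_linear L" "open S"
  shows "Cinf_on S L"
proof -
  have "Ck_on k S (\<lambda>x. x)" for k
    \<comment> \<open>A case distinction replaces induction, because the derivative of the identity
      in direction \<open>v\<close> is the constant \<open>v\<close>.\<close>
    by (cases k) (auto intro!: Ck_on_SucI[OF assms(2), where D = "\<lambda>x v. v"] Ck_on_const assms(2))
  then show ?thesis
    unfolding Cinf_on_def using Ck_on_bounded_linear_comp[OF assms] by blast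
qed

lemma Ck_on_add:
  assumes "open S"
  shows "Ck_on k S f \<Longrightarrow> Ck_on k S g \<Longrightarrow> Ck_on k S (\<lambda>x. f x + g x)"
proof (induction k arbitrary: f g)
  case 0
  then show ?case by (simp add: continuous_on_add)
next
  case (Suc k)
  show ?case
    by (rule Ck_on_SucI[OF assms has_derivative_add[OF
          Ck_on_SucD(1)[OF Suc.prems(1)] Ck_on_SucD(1)[OF Suc.prems(2)]]])
      (use Suc.IH Ck_on_SucD(2)[OF Suc.prems(1)] Ck_on_SucD(2)[OF Suc.prems(2)] in auto)
qed

lemma Ck_on_sum:
  assumes "open S" "finite I" "\<And>i. i \<in> I \<Longrightarrow> Ck_on k S (f i)"
  shows "Ck_on k S (\<lambda>x. \<Sum>i\<in>I. f i x)"
  using assms(2,3) by (induction I) (auto intro: Ck_on_add Ck_on_const assms(1))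

lemma Ck_on_scaleR:
  assumes "open S"
  shows "Ck_on k S f \<Longrightarrow> Ck_on k S g \<Longrightarrow> Ck_on k S (\<lambda>x. f x *\<^sub>R g x)"
proof (induction k arbitrary: f g)
  case 0
  then show ?case by (simp add: continuous_on_scaleR)
next
  case (Suc k)
  show ?case
    by (rule Ck_on_SucI[OF assms has_derivative_scaleR[OF
          Ck_on_SucD(1)[OF Suc.prems(1)] Ck_on_SucD(1)[OF Suc.prems(2)]]])
      (use Suc.IH Ck_on_SucD(2)[OF Suc.prems(1)] Ck_on_SucD(2)[OF Suc.prems(2)]
         Suc.prems[THEN Ck_on_Suc_imp] in \<open>auto intro!: Ck_on_add[OF assms]\<close>)
qed

lemma Ck_on_compose:
  fixes f :: "'b::euclidean_space \<Rightarrow> 'c::real_normed_vector"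
  assumes "open S" "g ` S \<subseteq> T"
  shows "Ck_on k T f \<Longrightarrow> Ck_on k S g \<Longrightarrow> Ck_on k S (f \<circ> g)"
proof (induction k arbitrary: f)
  case 0
  then show ?case using assms(2) by (auto simp: o_def intro: continuous_on_compose2)
next
  case (Suc k)
  note df = Ck_on_SucD[OF Suc.prems(1)] and dg = Ck_on_SucD[OF Suc.prems(2)]
  \<comment> \<open>In the chain rule the direction \<open>frechet_derivative g (at x) v\<close>
    varies with \<open>x\<close>, whereas \<open>Ck_on\<close> controls derivatives of
    \<open>f\<close> in fixed directions only. Expanding over \<open>Basis\<close> leaves fixed
    directions \<open>b\<close> with scalar coefficients of class \<open>Ck_on k\<close>.\<close>
  define D where "D x v = (\<Sum>b\<in>Basis. (frechet_derivative g (at x) v \<bullet> b) *\<^sub>R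
      frechet_derivative f (at (g x)) b)" for x v
  show ?case
  proof (rule Ck_on_SucI[OF assms(1)])
    fix x assume x: "x \<in> S"
    have 1: "(f has_derivative frechet_derivative f (at (g x))) (at (g x))"
      using df(1) x assms(2) by blast
    have lin: "linear (frechet_derivative f (at (g x)))"
      using 1 has_derivative_linear by blast
    have "frechet_derivative f (at (g x)) (frechet_derivative g (at x) v) = D x v" for v
    proof -
      have "frechet_derivative f (at (g x)) (frechet_derivative g (at x) v) =
          frechet_derivative f (at (g x)) (\<Sum>b\<in>Basis. (frechet_derivative g (at x) v \<bullet> b) *\<^sub>R b)"
        by (simp only: euclidean_representation)
      then show ?thesis
        by (simp only: D_def linear_sum[OF lin] linear_cmul[OF lin])
    qed
    then have "frechet_derivative f (at (g x)) \<circ> frechet_derivative g (at x) = D x"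
      by auto
    then show "(f \<circ> g has_derivative D x) (at x)"
      using diff_chain_at[OF dg(1)[OF x] 1] by simp
  next
    fix v
    have "Ck_on k S (\<lambda>x. frechet_derivative f (at (g x)) b)" for b
      using Suc.IH[OF df(2) Ck_on_Suc_imp[OF Suc.prems(2)]] by (simp add: o_def)
    then show "Ck_on k S (\<lambda>x. D x v)"
      unfolding D_def
      by (intro Ck_on_sum Ck_on_scaleR Ck_on_bounded_linear_comp[OF bounded_linear_inner_left]
          dg(2) assms(1)) auto
  qed
qed

lemma Cinf_on_compose:
  fixes f :: "'b::euclidean_space \<Rightarrow> 'c::real_normed_vector"
  assumes "open S" "g ` S \<subseteq> T" "Cinf_on T f" "Cinf_on S g"
  shows "Cinf_on S (f \<circ> g)"
  using Ck_on_compose[OF assms(1,2)] assms(3,4) unfolding Cinf_on_def by blast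

section \<open>Tangent vectors in charts\<close>

lemma smooth_manifoldD:
  assumes "smooth_manifold A" "(U, \<phi>) \<in> A"
  shows "inj_on \<phi> U" "open (\<phi> ` U)"
    and "(V, \<psi>) \<in> A \<Longrightarrow> open (\<phi> ` (U \<inter> V))"
    and "(V, \<psi>) \<in> A \<Longrightarrow> Cinf_on (\<phi> ` (U \<inter> V)) (\<psi> \<circ> inv_into U \<phi>)"
  using assms unfolding smooth_manifold_def by fast+

lemma pointsE:
  assumes "p \<in> points A"
  obtains U \<phi> where "(U, \<phi>) \<in> A" "p \<in> U"
  using assms unfolding points_def by auto

lemma pointsI: "(U, \<phi>) \<in> A \<Longrightarrow> p \<in> U \<Longrightarrow> p \<in> points A"
  unfolding points_def by blast

lemma smooth_nearD:
  assumes "smooth_near A p f" "(U, \<phi>) \<in> A" "p \<in> U"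
  obtains T where "open T" "\<phi> p \<in> T" "T \<subseteq> \<phi> ` U" "Cinf_on T (f \<circ> inv_into U \<phi>)"
  using assms unfolding smooth_near_def by fast

lemma smooth_mapD:
  assumes "smooth_map A B F" "(U, \<phi>) \<in> A" "p \<in> U" "(V, \<psi>) \<in> B" "F p \<in> V"
  obtains T where "open T" "\<phi> p \<in> T" "T \<subseteq> \<phi> ` {r \<in> U. F r \<in> V}"
    "Cinf_on T (\<psi> \<circ> F \<circ> inv_into U \<phi>)"
proof -
  have "p \<in> points A" by (rule pointsI[OF assms(2,3)])
  then show ?thesis using assms that unfolding smooth_map_def by fast
qed

lemma smooth_map_points: "smooth_map A B F \<Longrightarrow> p \<in> points A \<Longrightarrow> F p \<in> points B"
  unfolding smooth_map_def by blast

text \<open>One factorisation through a chart of the target, valid on one open set, serves both the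
  smoothness of \<open>h \<circ> F\<close> and the chain rule for
  \<open>pushforward\<close>.\<close>

lemma smooth_map_comp_local:
  fixes A :: "('p, 'e::euclidean_space) atlas" and B :: "('r, 'd::euclidean_space) atlas"
  assumes A: "smooth_manifold A" and B: "smooth_manifold B" and F: "smooth_map A B F"
    and U: "(U, \<phi>) \<in> A" "p \<in> U" and V: "(V, \<psi>) \<in> B" "F p \<in> V"
    and h: "smooth_near B (F p) h"
  obtains S T where "open S" "\<phi> p \<in> S" "S \<subseteq> \<phi> ` U" "Cinf_on S (\<psi> \<circ> F \<circ> inv_into U \<phi>)"
    "Cinf_on T (h \<circ> inv_into V \<psi>)" "(\<psi> \<circ> F \<circ> inv_into U \<phi>) ` S \<subseteq> T"
    "\<forall>x\<in>S. ((h \<circ> inv_into V \<psi>) \<circ> (\<psi> \<circ> F \<circ> inv_into U \<phi>)) x = (h \<circ> F \<circ> inv_into U \<phi>) x"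
proof -
  let ?g = "\<psi> \<circ> F \<circ> inv_into U \<phi>"
  obtain T where T: "open T" "\<psi> (F p) \<in> T" "T \<subseteq> \<psi> ` V" "Cinf_on T (h \<circ> inv_into V \<psi>)"
    using smooth_nearD[OF h V] .
  obtain S where S: "open S" "\<phi> p \<in> S" "S \<subseteq> \<phi> ` {r \<in> U. F r \<in> V}" "Cinf_on S ?g"
    using smooth_mapD[OF F U V] .
  note injU = smooth_manifoldD(1)[OF A U(1)] and injV = smooth_manifoldD(1)[OF B V(1)]
  \<comment> \<open>Shrinking to the preimage of \<open>T\<close> keeps the values of
    \<open>?g\<close> where the chart expression of \<open>h\<close> is smooth.\<close>
  define S' where "S' = S \<inter> ?g -` T"
  have "open S'"
    using continuous_open_preimage[OF Cinf_on_continuous[OF S(4)] S(1) T(1)] by (simp only: S'_def)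
  moreover have "\<phi> p \<in> S'"
    using S(2) T(2) injU U(2) by (simp add: S'_def)
  moreover have "((h \<circ> inv_into V \<psi>) \<circ> ?g) x = (h \<circ> F \<circ> inv_into U \<phi>) x" if "x \<in> S'" for x
  proof -
    obtain r where "r \<in> U" "F r \<in> V" "x = \<phi> r" using \<open>x \<in> S'\<close> S(3) unfolding S'_def by blast
    then show ?thesis using injU injV by simp
  qed
  moreover have "S' \<subseteq> S" "?g ` S' \<subseteq> T" "S' \<subseteq> \<phi> ` U" using S(3) unfolding S'_def by auto
  ultimately show thesis
    using that[of S' T] T(4) Cinf_on_subset[OF S(4)] by blast
qed

lemma smooth_near_comp:
  fixes A :: "('p, 'e::euclidean_space) atlas" and B :: "('r, 'd::euclidean_space) atlas"
  assumes A: "smooth_manifold A" and B: "smooth_manifold B" and F: "smooth_map A B F"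
    and p: "p \<in> points A" and h: "smooth_near B (F p) h"
  shows "smooth_near A p (h \<circ> F)"
proof -
  obtain V \<psi> where V: "(V, \<psi>) \<in> B" "F p \<in> V"
    using smooth_map_points[OF F p] by (rule pointsE)
  have "\<exists>S. open S \<and> \<phi> p \<in> S \<and> S \<subseteq> \<phi> ` U \<and> Cinf_on S (h \<circ> F \<circ> inv_into U \<phi>)"
    if U: "(U, \<phi>) \<in> A" "p \<in> U" for U \<phi>
  proof -
    obtain S T where S: "open S" "\<phi> p \<in> S" "S \<subseteq> \<phi> ` U" "Cinf_on S (\<psi> \<circ> F \<circ> inv_into U \<phi>)"
      "Cinf_on T (h \<circ> inv_into V \<psi>)" "(\<psi> \<circ> F \<circ> inv_into U \<phi>) ` S \<subseteq> T"
      "\<forall>x\<in>S. ((h \<circ> inv_into V \<psi>) \<circ> (\<psi> \<circ> F \<circ> inv_into U \<phi>)) x = (h \<circ> F \<circ> inv_into U \<phi>) x"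
      using smooth_map_comp_local[OF A B F U V h] .
    have "Cinf_on S (h \<circ> F \<circ> inv_into U \<phi>)"
      using Cinf_on_cong[OF S(1) bspec[OF S(7)] Cinf_on_compose[OF S(1,6,5,4)]] .
    then show ?thesis using S(1,2,3) by blast
  qed
  then show ?thesis unfolding smooth_near_def by auto
qed

text \<open>This is the chain rule: in charts the tangent map acts on components by the derivative
  of the chart expression of \<open>F\<close>. On an \<open>h\<close> that is not smooth near
  \<open>F p\<close> both sides have the default value \<open>0\<close>.\<close>

lemma pushforward_coord_deriv:
  fixes A :: "('p, 'e::euclidean_space) atlas" and B :: "('r, 'd::euclidean_space) atlas"
  assumes A: "smooth_manifold A" and B: "smooth_manifold B" and F: "smooth_map A B F"
    and U: "(U, \<phi>) \<in> A" "p \<in> U" and V: "(V, \<psi>) \<in> B" "F p \<in> V"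
  shows "pushforward B F p (coord_deriv A (U, \<phi>) p e) =
    coord_deriv B (V, \<psi>) (F p) (frechet_derivative (\<psi> \<circ> F \<circ> inv_into U \<phi>) (at (\<phi> p)) e)"
proof
  fix h
  have p: "p \<in> points A" by (rule pointsI[OF U])
  show "pushforward B F p (coord_deriv A (U, \<phi>) p e) h =
    coord_deriv B (V, \<psi>) (F p) (frechet_derivative (\<psi> \<circ> F \<circ> inv_into U \<phi>) (at (\<phi> p)) e) h"
  proof (cases "smooth_near B (F p) h")
    case True
    let ?g = "\<psi> \<circ> F \<circ> inv_into U \<phi>" and ?h = "h \<circ> inv_into V \<psi>"
    obtain S T where S: "open S" "\<phi> p \<in> S" "S \<subseteq> \<phi> ` U" "Cinf_on S ?g"
      "Cinf_on T ?h" "?g ` S \<subseteq> T" "\<forall>x\<in>S. (?h \<circ> ?g) x = (h \<circ> F \<circ> inv_into U \<phi>) x"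
      using smooth_map_comp_local[OF A B F U V True] .
    have dg: "?g differentiable at (\<phi> p)" and dh: "?h differentiable at (?g (\<phi> p))"
      using S Cinf_on_differentiable by blast+
    have gp: "?g (\<phi> p) = \<psi> (F p)" using smooth_manifoldD(1)[OF A U(1)] U(2) by simp
    have "frechet_derivative (h \<circ> F \<circ> inv_into U \<phi>) (at (\<phi> p)) = frechet_derivative (?h \<circ> ?g) (at (\<phi> p))"
      by (rule frechet_derivative_cong_open(2)[OF S(1,2) bspec[OF S(7)] differentiable_chain_at[OF dg dh]])
    then have "frechet_derivative (h \<circ> F \<circ> inv_into U \<phi>) (at (\<phi> p)) =
        frechet_derivative ?h (at (\<psi> (F p))) \<circ> frechet_derivative ?g (at (\<phi> p))"
      using frechet_derivative_compose[OF dg dh] by (simp only: gp)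
    then show ?thesis
      using True smooth_near_comp[OF A B F p True]
      by (simp add: pushforward_def coord_deriv_def)
  qed (simp add: pushforward_def coord_deriv_def)
qed

lemma tangent_spaceE:
  assumes "v \<in> tangent_space A p"
  obtains U \<phi> e where "(U, \<phi>) \<in> A" "p \<in> U" "v = coord_deriv A (U, \<phi>) p e"
  using assms unfolding tangent_space_def by force

lemma coord_deriv_tangent: "(U, \<phi>) \<in> A \<Longrightarrow> p \<in> U \<Longrightarrow> coord_deriv A (U, \<phi>) p e \<in> tangent_space A p"
  unfolding tangent_space_def by force

lemma pushforward_tangent:
  fixes A :: "('p, 'e::euclidean_space) atlas" and B :: "('r, 'd::euclidean_space) atlas"
  assumes "smooth_manifold A" "smooth_manifold B" "smooth_map A B F" "v \<in> tangent_space A p"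
  shows "pushforward B F p v \<in> tangent_space B (F p)"
proof -
  obtain U \<phi> e where U: "(U, \<phi>) \<in> A" "p \<in> U" "v = coord_deriv A (U, \<phi>) p e"
    using assms(4) by (rule tangent_spaceE)
  then have "p \<in> points A" by (blast intro: pointsI)
  then obtain V \<psi> where V: "(V, \<psi>) \<in> B" "F p \<in> V"
    using smooth_map_points[OF assms(3)] pointsE by metis
  show ?thesis
    using coord_deriv_tangent[OF V] pushforward_coord_deriv[OF assms(1-3) U(1,2) V] U(3) by simp
qed

text \<open>\<open>tangent_space\<close> is a union over all charts. Applying
  \<open>pushforward_coord_deriv\<close> to the identity turns a coordinate vector of any chart into
  one of the given chart, by means of the transition map.\<close>

lemma tangent_space_chart:
  fixes A :: "('p, 'e::euclidean_space) atlas"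
  assumes A: "smooth_manifold A" and V: "(V, \<psi>) \<in> A" "p \<in> V"
  shows "tangent_space A p = range (coord_deriv A (V, \<psi>) p)"
proof
  show "range (coord_deriv A (V, \<psi>) p) \<subseteq> tangent_space A p"
    using coord_deriv_tangent[OF V] by auto
  have id: "smooth_map A A (\<lambda>r. r)"
    unfolding smooth_map_def
  proof (intro ballI conjI, simp, clarify)
    fix q U \<phi> W \<eta>
    assume q: "(U, \<phi>) \<in> A" "(W, \<eta>) \<in> A" "q \<in> U" "q \<in> W"
    show "\<exists>T. open T \<and> \<phi> q \<in> T \<and> T \<subseteq> \<phi> ` {r \<in> U. r \<in> W} \<and>
        Cinf_on T (\<eta> \<circ> (\<lambda>r. r) \<circ> inv_into U \<phi>)"
      using smooth_manifoldD(3,4)[OF A q(1,2)] q(3,4)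
      by (intro exI[of _ "\<phi> ` (U \<inter> W)"]) (auto simp: o_def)
  qed
  show "tangent_space A p \<subseteq> range (coord_deriv A (V, \<psi>) p)"
  proof
    fix v assume "v \<in> tangent_space A p"
    then obtain U \<phi> e where U: "(U, \<phi>) \<in> A" "p \<in> U" "v = coord_deriv A (U, \<phi>) p e"
      by (rule tangent_spaceE)
    \<comment> \<open>Here it matters that \<open>v\<close>, like every pushforward, is
      \<open>0\<close> on functions not smooth near \<open>p\<close>.\<close>
    have "pushforward A (\<lambda>r. r) p v = v"
      unfolding U(3) pushforward_def coord_deriv_def by (auto simp: o_def)
    then show "v \<in> range (coord_deriv A (V, \<psi>) p)"
      using pushforward_coord_deriv[OF A A id U(1,2) V] U(3) by (metis rangeI)
  qed
qed

lemma coord_deriv_linear: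
  fixes A :: "('p, 'e::euclidean_space) atlas"
  assumes "(U, \<phi>) \<in> A" "p \<in> U"
  shows "coord_deriv A (U, \<phi>) p (e + e') = coord_deriv A (U, \<phi>) p e + coord_deriv A (U, \<phi>) p e'"
    and "coord_deriv A (U, \<phi>) p (c *\<^sub>R e) = fscale c (coord_deriv A (U, \<phi>) p e)"
proof -
  have lin: "linear (frechet_derivative (f \<circ> inv_into U \<phi>) (at (\<phi> p)))" if "smooth_near A p f" for f
    using smooth_nearD[OF that assms] Cinf_on_differentiable linear_frechet_derivative by metis
  show "coord_deriv A (U, \<phi>) p (e + e') = coord_deriv A (U, \<phi>) p e + coord_deriv A (U, \<phi>) p e'"
    and "coord_deriv A (U, \<phi>) p (c *\<^sub>R e) = fscale c (coord_deriv A (U, \<phi>) p e)"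
    using lin by (auto simp: coord_deriv_def fscale_def fun_eq_iff linear_add linear_cmul)
qed

text \<open>Closure under addition is visible only after passing to a single chart, where the
  tangent space is the image of a linear map.\<close>

lemma subspace_tangent_space:
  fixes A :: "('p, 'e::euclidean_space) atlas"
  assumes A: "smooth_manifold A" and p: "p \<in> points A"
  shows "fn.subspace (tangent_space A p)"
proof -
  obtain U \<phi> where U: "(U, \<phi>) \<in> A" "p \<in> U" using p by (rule pointsE)
  have "coord_deriv A (U, \<phi>) p 0 = 0"
    using coord_deriv_linear(2)[OF U, of 0 0] by (simp add: fscale_def fun_eq_iff)
  then show ?thesis
    unfolding tangent_space_chart[OF A U] fn.subspace_def
    by (auto simp flip: coord_deriv_linear[OF U])
qed

text \<open>In any other chart the coordinate function is a component of a transition map; in its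
  own chart it is a linear projection. The second claim lets components be read off from a tangent
  vector.\<close>

lemma chart_component:
  fixes A :: "('p, real^'m::finite) atlas"
  assumes A: "smooth_manifold A" and U: "(U, \<phi>) \<in> A" "p \<in> U"
  shows "smooth_near A p (\<lambda>r. \<phi> r $ a)" "coord_deriv A (U, \<phi>) p e (\<lambda>r. \<phi> r $ a) = e $ a"
proof -
  have "\<exists>S. open S \<and> \<psi> p \<in> S \<and> S \<subseteq> \<psi> ` V \<and> Cinf_on S ((\<lambda>r. \<phi> r $ a) \<circ> inv_into V \<psi>)"
    if V: "(V, \<psi>) \<in> A" "p \<in> V" for V \<psi>
  proof -
    have "Cinf_on (\<psi> ` (V \<inter> U)) ((\<lambda>x. x $ a) \<circ> (\<phi> \<circ> inv_into V \<psi>))"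
      by (rule Cinf_on_compose[OF smooth_manifoldD(3)[OF A V(1) U(1)] subset_UNIV
            Cinf_on_bounded_linear[OF bounded_linear_vec_nth] smooth_manifoldD(4)[OF A V(1) U(1)]])
        simp
    then show ?thesis
      using smooth_manifoldD(3)[OF A V(1) U(1)] U(2) V(2)
      by (intro exI[of _ "\<psi> ` (V \<inter> U)"]) (auto simp: o_def)
  qed
  then show s: "smooth_near A p (\<lambda>r. \<phi> r $ a)"
    unfolding smooth_near_def by auto
  have "((\<lambda>x. x $ a) has_derivative (\<lambda>x. x $ a)) (at (\<phi> p))"
    by (rule bounded_linear.has_derivative[OF bounded_linear_vec_nth has_derivative_ident])
  then have "(((\<lambda>r. \<phi> r $ a) \<circ> inv_into U \<phi>) has_derivative (\<lambda>x. x $ a)) (at (\<phi> p))"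
    by (rule has_derivative_transform_within_open[OF _ smooth_manifoldD(2)[OF A U(1)]])
      (use U(2) smooth_manifoldD(1)[OF A U(1)] in auto)
  then show "coord_deriv A (U, \<phi>) p e (\<lambda>r. \<phi> r $ a) = e $ a"
    using s by (simp add: coord_deriv_def frechet_derivative_at[symmetric])
qed

lemma fscale_sum_apply: "(\<Sum>a\<in>I. fscale (c a) (v a)) f = (\<Sum>a\<in>I. c a * v a f)"
  by (induction I rule: infinite_finite_induct) (auto simp: fscale_def)

lemma coord_deriv_expand:
  fixes A :: "('p, real^'m::finite) atlas"
  assumes U: "(U, \<phi>) \<in> A" "p \<in> U"
  shows "coord_deriv A (U, \<phi>) p e = (\<Sum>a\<in>UNIV. fscale (e $ a) (coord_deriv A (U, \<phi>) p (axis a 1)))"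
proof -
  have 0: "coord_deriv A (U, \<phi>) p 0 = 0"
    using coord_deriv_linear(2)[OF U, of 0 0] by (simp add: fscale_def fun_eq_iff)
  have *: "coord_deriv A (U, \<phi>) p (\<Sum>a\<in>I. e $ a *\<^sub>R axis a 1) =
      (\<Sum>a\<in>I. fscale (e $ a) (coord_deriv A (U, \<phi>) p (axis a 1)))" if "finite I" for I
    using that by (induction I) (simp_all add: 0 coord_deriv_linear[OF U])
  have "(\<Sum>a\<in>UNIV. e $ a *\<^sub>R axis a 1) = e"
    using basis_expansion[of e] by (simp add: scalar_mult_eq_scaleR)
  then show ?thesis using *[of UNIV] by simp
qed

section \<open>Tangent vectors of the tangent bundle\<close>

text \<open>The point over \<open>(x, y)\<close> is the coordinate vector with components
  \<open>y\<close> at the point with coordinates \<open>x\<close>. For the inverse chart only the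
  base point is computed, which is all that functions pulled back along \<open>fst\<close> depend
  on.\<close>

lemma tangent_atlas_chart_inverse:
  fixes A :: "('p, real^'m::finite) atlas"
  assumes A: "smooth_manifold A" and U: "(U, \<phi>) \<in> A" and x: "x \<in> \<phi> ` U"
  defines "W \<equiv> {(p, v). p \<in> U \<and> v \<in> tangent_space A p}"
    and "\<Phi> \<equiv> \<lambda>(p, v). (\<phi> p, \<chi> a. v (\<lambda>r. \<phi> r $ a))"
  shows "(x, y) \<in> \<Phi> ` W" "fst (inv_into W \<Phi> (x, y)) = inv_into U \<phi> x"
proof -
  obtain r where r: "r \<in> U" "x = \<phi> r" using x by blast
  have "(r, coord_deriv A (U, \<phi>) r y) \<in> W"
    using r coord_deriv_tangent[OF U r(1)] by (simp add: W_def)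
  moreover have "\<Phi> (r, coord_deriv A (U, \<phi>) r y) = (x, y)"
    using r chart_component(2)[OF A U r(1)] by (simp add: \<Phi>_def vec_eq_iff)
  ultimately show *: "(x, y) \<in> \<Phi> ` W" by (metis image_eqI)
  let ?z = "inv_into W \<Phi> (x, y)"
  have "?z \<in> W" "\<Phi> ?z = (x, y)" using inv_into_into[OF *] f_inv_into_f[OF *] by auto
  then have "fst ?z \<in> U" "\<phi> (fst ?z) = x" by (auto simp: W_def \<Phi>_def split: prod.splits)
  then show "fst ?z = inv_into U \<phi> x"
    using inv_into_f_eq[OF smooth_manifoldD(1)[OF A U]] by metis
qed

text \<open>In induced coordinates a pulled-back function is a function of \<open>x\<close> alone,
  so its derivative does not see the velocity direction \<open>e2\<close>. This is the source of
  semibasicity.\<close>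

lemma tangent_atlas_comp_fst:
  fixes A :: "('p, real^'m::finite) atlas"
  assumes A: "smooth_manifold A" and U: "(U, \<phi>) \<in> A" and p: "p \<in> U"
    and h: "smooth_near A p h"
  defines "W \<equiv> {(p, v). p \<in> U \<and> v \<in> tangent_space A p}"
    and "\<Phi> \<equiv> \<lambda>(p, v). (\<phi> p, \<chi> a. v (\<lambda>r. \<phi> r $ a))"
  obtains T where "open T" "\<phi> p \<in> T" "T \<times> UNIV \<subseteq> \<Phi> ` W"
    "Cinf_on (T \<times> UNIV) (h \<circ> fst \<circ> inv_into W \<Phi>)"
    "\<forall>x\<in>T. \<forall>y e1 e2. frechet_derivative (h \<circ> fst \<circ> inv_into W \<Phi>) (at (x, y)) (e1, e2)
      = frechet_derivative (h \<circ> inv_into U \<phi>) (at x) e1"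
proof -
  obtain T where T: "open T" "\<phi> p \<in> T" "T \<subseteq> \<phi> ` U" "Cinf_on T (h \<circ> inv_into U \<phi>)"
    using smooth_nearD[OF h U p] .
  note inv = tangent_atlas_chart_inverse[OF A U, folded W_def \<Phi>_def]
  have o: "open (T \<times> (UNIV :: (real^'m) set))" using T(1) by (simp add: open_Times)
  have eq: "((h \<circ> inv_into U \<phi>) \<circ> fst) z = (h \<circ> fst \<circ> inv_into W \<Phi>) z" if "z \<in> T \<times> UNIV" for z
    using that T(3) inv(2)[of "fst z" "snd z"] by auto
  have "Cinf_on (T \<times> UNIV) ((h \<circ> inv_into U \<phi>) \<circ> (fst :: (real^'m) \<times> (real^'m) \<Rightarrow> _))"
    by (rule Cinf_on_compose[OF o _ T(4) Cinf_on_bounded_linear[OF bounded_linear_fst o]]) auto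
  then have C: "Cinf_on (T \<times> UNIV) (h \<circ> fst \<circ> inv_into W \<Phi>)"
    using Cinf_on_cong[OF o, of "(h \<circ> inv_into U \<phi>) \<circ> fst" "h \<circ> fst \<circ> inv_into W \<Phi>"] eq by simp
  have D: "frechet_derivative (h \<circ> fst \<circ> inv_into W \<Phi>) (at (x, y)) (e1, e2)
      = frechet_derivative (h \<circ> inv_into U \<phi>) (at x) e1" if x: "x \<in> T" for x y e1 e2
  proof -
    have "(h \<circ> inv_into U \<phi> has_derivative frechet_derivative (h \<circ> inv_into U \<phi>) (at x)) (at (fst (x, y)))"
      using Cinf_on_differentiable[OF T(4) x] frechet_derivative_works by auto
    with has_derivative_fst[OF has_derivative_ident, of "at (x, y)"]
    have "((h \<circ> inv_into U \<phi>) \<circ> fst has_derivative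
        frechet_derivative (h \<circ> inv_into U \<phi>) (at x) \<circ> fst) (at (x, y))"
      by (rule diff_chain_at)
    then have "(h \<circ> fst \<circ> inv_into W \<Phi> has_derivative
        frechet_derivative (h \<circ> inv_into U \<phi>) (at x) \<circ> fst) (at (x, y))"
      by (rule has_derivative_transform_within_open[OF _ o]) (use eq x in auto)
    then show ?thesis by (simp add: frechet_derivative_at[symmetric])
  qed
  have sub: "T \<times> UNIV \<subseteq> \<Phi> ` W"
  proof
    fix z :: "(real^'m) \<times> (real^'m)" assume "z \<in> T \<times> UNIV"
    then show "z \<in> \<Phi> ` W" using T(3) inv(1)[of "fst z" "snd z"] by auto
  qed
  show thesis by (rule that[OF T(1,2) sub C]) (simp add: D)
qed

text \<open>Since \<open>coord_deriv\<close> returns \<open>0\<close> on functions that are not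
  smooth, \<open>h \<circ> fst\<close> must first be shown smooth in every induced chart before the
  derivative can be compared.\<close>

lemma tangent_atlas_fst:
  fixes A :: "('p, real^'m::finite) atlas"
  assumes A: "smooth_manifold A" and h: "smooth_near A p h" and U: "(U, \<phi>) \<in> A" "p \<in> U"
    and v: "v \<in> tangent_space A p"
  shows "coord_deriv (tangent_atlas A) ({(p, v). p \<in> U \<and> v \<in> tangent_space A p},
       \<lambda>(p, v). (\<phi> p, \<chi> a. v (\<lambda>r. \<phi> r $ a))) (p, v) (e1, e2) (h \<circ> fst)
     = coord_deriv A (U, \<phi>) p e1 h"
proof -
  have "smooth_near (tangent_atlas A) (p, v) (h \<circ> fst)"
    unfolding smooth_near_def
  proof (clarify)
    fix W and \<Phi> :: "_ \<Rightarrow> (real^'m) \<times> (real^'m)" assume "(W, \<Phi>) \<in> tangent_atlas A" and z: "(p, v) \<in> W"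
    then obtain V \<psi> where V: "(V, \<psi>) \<in> A" "W = {(p, v). p \<in> V \<and> v \<in> tangent_space A p}"
      "\<Phi> = (\<lambda>(p, v). (\<psi> p, \<chi> a. v (\<lambda>r. \<psi> r $ a)))"
      unfolding tangent_atlas_def by blast
    have "p \<in> V" using z V(2) by simp
    from tangent_atlas_comp_fst[OF A V(1) \<open>p \<in> V\<close> h, folded V(2,3)]
    obtain T where "open T" "\<psi> p \<in> T" "T \<times> UNIV \<subseteq> \<Phi> ` W"
      "Cinf_on (T \<times> UNIV) (h \<circ> fst \<circ> inv_into W \<Phi>)" .
    then show "\<exists>S. open S \<and> \<Phi> (p, v) \<in> S \<and> S \<subseteq> \<Phi> ` W \<and> Cinf_on S (h \<circ> fst \<circ> inv_into W \<Phi>)"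
      using V(3) by (intro exI[of _ "T \<times> UNIV"]) (auto simp: open_Times)
  qed
  moreover obtain T where T: "\<phi> p \<in> T" "\<forall>x\<in>T. \<forall>y e1 e2.
      frechet_derivative (h \<circ> fst \<circ> inv_into {(p, v). p \<in> U \<and> v \<in> tangent_space A p}
        (\<lambda>(p, v). (\<phi> p, \<chi> a. v (\<lambda>r. \<phi> r $ a)))) (at (x, y)) (e1, e2)
      = frechet_derivative (h \<circ> inv_into U \<phi>) (at x) e1"
    using tangent_atlas_comp_fst[OF A U h] .
  ultimately show ?thesis
    using h T(2)[rule_format, OF T(1)] by (simp add: coord_deriv_def)
qed

text \<open>The vector \<open>u\<close> is the projection of \<open>w\<close> to the base, with
  components the first half of those of \<open>w\<close>; it is characterised by its action on
  pulled-back functions.\<close>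

lemma tangent_bundle_vector_fst:
  fixes A :: "('p, real^'m::finite) atlas"
  assumes A: "smooth_manifold A" and v: "v \<in> tangent_space A p"
    and w: "w \<in> tangent_space (tangent_atlas A) (p, v)"
  obtains u where "u \<in> tangent_space A p" "\<And>h. smooth_near A p h \<Longrightarrow> w (h \<circ> fst) = u h"
proof -
  obtain W \<Phi> e where W: "(W, \<Phi>) \<in> tangent_atlas A" "(p, v) \<in> W"
    "w = coord_deriv (tangent_atlas A) (W, \<Phi>) (p, v) e"
    using w by (rule tangent_spaceE)
  then obtain U \<phi> where U: "(U, \<phi>) \<in> A" "W = {(p, v). p \<in> U \<and> v \<in> tangent_space A p}"
      "\<Phi> = (\<lambda>(p, v). (\<phi> p, \<chi> a. v (\<lambda>r. \<phi> r $ a)))"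
    unfolding tangent_atlas_def by blast
  obtain e1 e2 where e: "e = (e1, e2)" by force
  have p: "p \<in> U" using W(2) U(2) by simp
  show thesis
    using that[OF coord_deriv_tangent[OF U(1) p, of e1]] tangent_atlas_fst[OF A _ U(1) p v]
    unfolding W(3) U(2,3) e by blast
qed

text \<open>The lift is the induced coordinate vector with components \<open>(e, 0)\<close>. Thus
  every base vector is attained at every velocity \<open>v\<close>.\<close>

lemma tangent_bundle_vector_lift:
  fixes A :: "('p, real^'m::finite) atlas"
  assumes A: "smooth_manifold A" and v: "v \<in> tangent_space A p" and u: "u \<in> tangent_space A p"
  obtains w where "w \<in> tangent_space (tangent_atlas A) (p, v)"
    "\<And>h. smooth_near A p h \<Longrightarrow> w (h \<circ> fst) = u h"
proof -
  obtain U \<phi> e where U: "(U, \<phi>) \<in> A" "p \<in> U" "u = coord_deriv A (U, \<phi>) p e"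
    using u by (rule tangent_spaceE)
  have "({(p, v). p \<in> U \<and> v \<in> tangent_space A p},
       \<lambda>(p, v). (\<phi> p, \<chi> a. v (\<lambda>r. \<phi> r $ a))) \<in> tangent_atlas A"
    using U(1) unfolding tangent_atlas_def by blast
  from coord_deriv_tangent[OF this, of "(p, v)" "(e, 0)"] show thesis
    using that tangent_atlas_fst[OF A _ U(1,2) v, of _ e 0] U(2,3) v by blast
qed

section \<open>Symmetric tensors\<close>

lemma symmetric_tensorD:
  assumes "symmetric_tensor A g" "p \<in> points A" "u \<in> tangent_space A p" "v \<in> tangent_space A p"
  shows "g p u v = g p v u"
    and "w \<in> tangent_space A p \<Longrightarrow> g p (u + w) v = g p u v + g p w v"
    and "g p (fscale c u) v = c * g p u v"
  using assms unfolding symmetric_tensor_def by blast+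

text \<open>Linearity is postulated in the first slot and only on tangent vectors; symmetry carries
  it to the second slot once the sum is known to be tangent.\<close>

lemma symmetric_tensor_add_right:
  fixes A :: "('p, 'e::euclidean_space) atlas"
  assumes "smooth_manifold A" and g: "symmetric_tensor A g" and p: "p \<in> points A"
    and "u \<in> tangent_space A p" "v \<in> tangent_space A p" "w \<in> tangent_space A p"
  shows "g p u (v + w) = g p u v + g p u w"
proof -
  have "v + w \<in> tangent_space A p"
    using subspace_tangent_space[OF assms(1) p] assms(5,6) by (rule fn.subspace_add)
  then show ?thesis
    using symmetric_tensorD(2)[OF g p assms(5,4,6)] symmetric_tensorD(1)[OF g p assms(4)] assms(5,6)
    by simp
qed

lemma symmetric_tensor_sum:
  fixes A :: "('p, 'e::euclidean_space) atlas"
  assumes A: "smooth_manifold A" and g: "symmetric_tensor A g" and p: "p \<in> points A"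
    and w: "w \<in> tangent_space A p" and v: "\<And>i. i \<in> I \<Longrightarrow> v i \<in> tangent_space A p"
    and I: "finite I"
  shows "g p (\<Sum>i\<in>I. fscale (c i) (v i)) w = (\<Sum>i\<in>I. c i * g p (v i) w)"
    and "g p w (\<Sum>i\<in>I. fscale (c i) (v i)) = (\<Sum>i\<in>I. c i * g p w (v i))"
proof -
  note sub = subspace_tangent_space[OF A p]
  have "0 \<in> tangent_space A p" using fn.subspace_0[OF sub] .
  then have g0: "g p 0 w = 0"
    using symmetric_tensorD(3)[OF g p _ w, of 0 0] by simp
  have fs: "\<And>i. i \<in> I \<Longrightarrow> fscale (c i) (v i) \<in> tangent_space A p"
    using fn.subspace_scale[OF sub] v by blast
  from I v fs show *: "g p (\<Sum>i\<in>I. fscale (c i) (v i)) w = (\<Sum>i\<in>I. c i * g p (v i) w)"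
  proof (induction I rule: finite_induct)
    case (insert i I)
    have "(\<Sum>i\<in>I. fscale (c i) (v i)) \<in> tangent_space A p"
      by (rule fn.subspace_sum[OF sub]) (simp add: insert.prems(2))
    moreover have "v i \<in> tangent_space A p" "fscale (c i) (v i) \<in> tangent_space A p"
      using insert.prems by blast+
    moreover have "g p (\<Sum>i\<in>I. fscale (c i) (v i)) w = (\<Sum>i\<in>I. c i * g p (v i) w)"
      using insert.IH insert.prems by blast
    ultimately show ?case
      by (simp only: sum.insert[OF insert.hyps] symmetric_tensorD(2,3)[OF g p _ w])
  qed (simp add: g0)
  have "(\<Sum>i\<in>I. fscale (c i) (v i)) \<in> tangent_space A p"
    by (rule fn.subspace_sum[OF sub fs])
  then have "g p w (\<Sum>i\<in>I. fscale (c i) (v i)) = g p (\<Sum>i\<in>I. fscale (c i) (v i)) w"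
    using symmetric_tensorD(1)[OF g p] w by blast
  also have "\<dots> = (\<Sum>i\<in>I. c i * g p w (v i))"
    unfolding * using symmetric_tensorD(1)[OF g p _ w] v by (auto intro: sum.cong)
  finally show "g p w (\<Sum>i\<in>I. fscale (c i) (v i)) = (\<Sum>i\<in>I. c i * g p w (v i))" .
qed

section \<open>Frames of a Chaplygin system\<close>

text \<open>Apart from the default value \<open>0\<close>, \<open>pushforward\<close> evaluates its
  argument on pulled-back functions, so it is linear on all functionals, tangent or not.\<close>

lemma pushforward_linear:
  "pushforward B F p (u + v) = pushforward B F p u + pushforward B F p v"
  "pushforward B F p (u - v) = pushforward B F p u - pushforward B F p v"
  "pushforward B F p (\<Sum>i\<in>I. fscale (c i) (w i)) = (\<Sum>i\<in>I. fscale (c i) (pushforward B F p (w i)))"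
  by (auto simp: pushforward_def fun_eq_iff fscale_sum_apply)

text \<open>Infinitesimal generators are pushforwards along these maps. Their chart expressions are
  those of the action restricted to the slice with second coordinate
  \<open>\<eta> q\<close>.\<close>

lemma smooth_map_orbit_map:
  fixes AG :: "('h, 'd::euclidean_space) atlas" and A :: "('p, 'e::euclidean_space) atlas"
  assumes AG: "smooth_manifold AG" and A: "smooth_manifold A"
    and act: "smooth_map (prod_atlas AG A) A (\<lambda>(h, q). act h q)" and q: "q \<in> points A"
  shows "smooth_map AG A (\<lambda>h. act h q)"
  unfolding smooth_map_def
proof (intro ballI conjI)
  obtain W \<eta> where W: "(W, \<eta>) \<in> A" "q \<in> W" using q by (rule pointsE)
  have prod: "(U \<times> W, map_prod \<phi> \<eta>) \<in> prod_atlas AG A" if "(U, \<phi>) \<in> AG" for U \<phi>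
    using that W(1) unfolding prod_atlas_def by blast
  fix h assume "h \<in> points AG"
  then obtain U \<phi> where U: "(U, \<phi>) \<in> AG" "h \<in> U" by (rule pointsE)
  have "(h, q) \<in> points (prod_atlas AG A)"
    by (rule pointsI[OF prod[OF U(1)]]) (simp add: U W)
  from smooth_map_points[OF act this] show "act h q \<in> points A" by simp
  show "case \<kappa> of (U, \<phi>) \<Rightarrow> \<forall>(V, \<psi>)\<in>A. h \<in> U \<longrightarrow> act h q \<in> V \<longrightarrow>
      (\<exists>S. open S \<and> \<phi> h \<in> S \<and> S \<subseteq> \<phi> ` {r \<in> U. act r q \<in> V} \<and>
        Cinf_on S (\<psi> \<circ> (\<lambda>h. act h q) \<circ> inv_into U \<phi>))" if "\<kappa> \<in> AG" for \<kappa>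
  proof (clarify)
    fix U \<phi> V \<psi> assume \<kappa>: "\<kappa> = (U, \<phi>)" and V: "(V, \<psi>) \<in> A" "act h q \<in> V" and h: "h \<in> U"
    have U: "(U, \<phi>) \<in> AG" using that \<kappa> by simp
    let ?g = "\<psi> \<circ> (\<lambda>(h, q). act h q) \<circ> inv_into (U \<times> W) (map_prod \<phi> \<eta>)"
    obtain T where T: "open T" "map_prod \<phi> \<eta> (h, q) \<in> T"
      "T \<subseteq> map_prod \<phi> \<eta> ` {r \<in> U \<times> W. (case r of (h, q) \<Rightarrow> act h q) \<in> V}" "Cinf_on T ?g"
      using smooth_mapD[OF act prod[OF U] _ V(1), of "(h, q)"] h W(2) V(2) by auto
    note inj = smooth_manifoldD(1)[OF AG U] smooth_manifoldD(1)[OF A W(1)]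
    define S where "S = (\<lambda>x. (x, \<eta> q)) -` T"
    have S: "open S" unfolding S_def
      by (rule open_vimage[OF T(1)]) (intro continuous_intros)
    have *: "\<exists>r\<in>U. x = \<phi> r \<and> act r q \<in> V" if "x \<in> S" for x
    proof -
      obtain r w where "r \<in> U" "w \<in> W" "act r w \<in> V" "x = \<phi> r" "\<eta> q = \<eta> w"
        using \<open>x \<in> S\<close> T(3) unfolding S_def by auto
      then show ?thesis using inj_onD[OF inj(2) _ W(2)] by metis
    qed
    have inv: "inv_into (U \<times> W) (map_prod \<phi> \<eta>) (\<phi> r, \<eta> q) = (r, q)" if "r \<in> U" for r
      using inv_into_f_f[OF map_prod_inj_on[OF inj], of "(r, q)"] that W(2) by simp
    \<comment> \<open>The inclusion of the slice is affine; its smoothness follows by splitting it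
      into a linear map and a constant.\<close>
    have "linear (\<lambda>x::'d. (x, 0::'e))" by (intro linearI) auto
    then have "Cinf_on S (\<lambda>x. (x, 0::'e))"
      using Cinf_on_bounded_linear[OF _ S] linear_conv_bounded_linear by blast
    then have "Cinf_on S (\<lambda>x. (x, 0) + (0, \<eta> q))"
      unfolding Cinf_on_def using Ck_on_add[OF S _ Ck_on_const[OF S]] by blast
    then have C: "Cinf_on S (\<lambda>x. (x, \<eta> q))" by simp
    have "Cinf_on S (?g \<circ> (\<lambda>x. (x, \<eta> q)))"
      by (rule Cinf_on_compose[OF S _ T(4) C]) (auto simp: S_def)
    moreover have "(?g \<circ> (\<lambda>x. (x, \<eta> q))) x = (\<psi> \<circ> (\<lambda>h. act h q) \<circ> inv_into U \<phi>) x" if "x \<in> S" for x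
      using *[OF that] inv inj(1) by auto
    ultimately have "Cinf_on S (\<psi> \<circ> (\<lambda>h. act h q) \<circ> inv_into U \<phi>)"
      using Cinf_on_cong[OF S] by blast
    moreover have "\<phi> h \<in> S" using T(2) by (simp add: S_def)
    moreover have "S \<subseteq> \<phi> ` {r \<in> U. act r q \<in> V}" using * by blast
    ultimately show "\<exists>S. open S \<and> \<phi> h \<in> S \<and> S \<subseteq> \<phi> ` {r \<in> U. act r q \<in> V} \<and>
        Cinf_on S (\<psi> \<circ> (\<lambda>h. act h q) \<circ> inv_into U \<phi>)"
      using S by blast
  qed
qed

section \<open>Splitting into horizontal and vertical vectors, and horizontal lifts\<close>

context
  fixes S :: "('q, 'n::finite, 'h, 'k::finite, 'm::finite) chaplygin"
  assumes S: "chaplygin_system S"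
begin

lemma chaplygin_manifolds:
  "smooth_manifold (Qatlas S)" "smooth_manifold (Gatlas S)" "smooth_manifold (Batlas S)"
  using S unfolding chaplygin_system_def lie_group_def orbit_manifold_def by blast+

lemma chaplygin_metric:
  "symmetric_tensor (Qatlas S) (metric_g S)"
  "q \<in> points (Qatlas S) \<Longrightarrow> v \<in> tangent_space (Qatlas S) q \<Longrightarrow> v \<noteq> 0 \<Longrightarrow> metric_g S q v v > 0"
  using S unfolding chaplygin_system_def riemannian_metric_def by blast+

lemma bproj_submersion:
  assumes "q \<in> points (Qatlas S)"
  shows "pushforward (Batlas S) (bproj S) q ` tangent_space (Qatlas S) q
    = tangent_space (Batlas S) (bproj S q)"
proof -
  have "orbit_manifold (Ggroup S) (Qatlas S) (Gact S) (Batlas S)"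
    using S unfolding chaplygin_system_def by (elim conjE)
  from this[unfolded orbit_manifold_def, folded bproj_def] show ?thesis
    using assms by simp
qed

lemma distr_vertical_split:
  assumes "q \<in> points (Qatlas S)"
  shows "distr S q \<inter> vertical S q = {0}"
    and "{u + v | u v. u \<in> distr S q \<and> v \<in> vertical S q} = tangent_space (Qatlas S) q"
proof -
  have "\<forall>q\<in>points (Qatlas S). distr S q \<inter> vertical S q = {0} \<and>
        {u + v | u v. u \<in> distr S q \<and> v \<in> vertical S q} = tangent_space (Qatlas S) q"
    using S unfolding chaplygin_system_def by (elim conjE)
  note * = bspec[OF this assms]
  show "distr S q \<inter> vertical S q = {0}"
    using * by (rule conjunct1)
  show "{u + v | u v. u \<in> distr S q \<and> v \<in> vertical S q} = tangent_space (Qatlas S) q"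
    using * by (rule conjunct2)
qed

lemma subspace_distr:
  assumes "q \<in> points (Qatlas S)"
  shows "fn.subspace (distr S q)"
proof -
  have "distribution_of_rank TYPE('m) (Qatlas S) (distr S)"
    using S unfolding chaplygin_system_def by blast
  then obtain V where "distr S q = fn.span V"
    using assms unfolding distribution_of_rank_def by meson
  then show ?thesis by (simp add: fn.subspace_span)
qed

lemma distr_tangent:
  assumes "q \<in> points (Qatlas S)" "v \<in> distr S q"
  shows "v \<in> tangent_space (Qatlas S) q"
proof -
  have "v + 0 \<in> {u + v | u v. u \<in> distr S q \<and> v \<in> vertical S q}"
    using distr_vertical_split(1)[OF assms(1)] assms(2) by blast
  then show ?thesis using distr_vertical_split(2)[OF assms(1)] by simp
qed

text \<open>This justifies the definite description. A lift exists because the projection is a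
  submersion and the vertical part of a preimage may be dropped; two lifts differ by a vector both
  horizontal and vertical, which is \<open>0\<close>.\<close>

lemma horizontal_lift:
  assumes q: "q \<in> points (Qatlas S)" and w: "w \<in> tangent_space (Batlas S) (bproj S q)"
  shows "horizontal_lift S q w \<in> distr S q"
    and "pushforward (Batlas S) (bproj S) q (horizontal_lift S q w) = w"
proof -
  let ?P = "pushforward (Batlas S) (bproj S) q"
  have "w \<in> ?P ` tangent_space (Qatlas S) q"
    using w by (simp only: bproj_submersion[OF q])
  then obtain v where v: "w = ?P v" "v \<in> tangent_space (Qatlas S) q" by (rule imageE)
  obtain u x where u: "u \<in> distr S q" "x \<in> vertical S q" "v = u + x"
    using v(2) unfolding distr_vertical_split(2)[OF q, symmetric] by blast
  have Pu: "?P u = w" using u v(1) by (simp add: pushforward_linear vertical_def)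
  have "u' = u" if u': "u' \<in> distr S q" "?P u' = w" for u'
  proof -
    have d: "u' - u \<in> distr S q" using fn.subspace_diff[OF subspace_distr[OF q] u'(1) u(1)] .
    moreover have "u' - u \<in> vertical S q"
      using distr_tangent[OF q d] Pu u'(2) by (simp add: vertical_def pushforward_linear)
    ultimately have "u' - u = 0" using distr_vertical_split(1)[OF q] by blast
    then show ?thesis by simp
  qed
  with u(1) Pu have "\<exists>!v. v \<in> distr S q \<and> ?P v = w" by blast
  from theI'[OF this] show "horizontal_lift S q w \<in> distr S q" "?P (horizontal_lift S q w) = w"
    unfolding horizontal_lift_def by blast+
qed

lemma inf_gen_tangent:
  assumes "lie_algebra_basis S \<xi>" and q: "q \<in> points (Qatlas S)"
  shows "inf_gen S \<xi> i q \<in> tangent_space (Qatlas S) q"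
proof -
  let ?one = "\<one>\<^bsub>Ggroup S\<^esub>"
  have "smooth_action (Ggroup S) (Gatlas S) (Qatlas S) (Gact S)"
    using S unfolding chaplygin_system_def by (elim conjE)
  then have act: "group_action (Ggroup S) (points (Qatlas S)) (Gact S)"
    "smooth_map (prod_atlas (Gatlas S) (Qatlas S)) (Qatlas S) (\<lambda>(h, q). Gact S h q)"
    unfolding smooth_action_def by (rule conjunct1, rule conjunct2)
  \<comment> \<open>The pushforward lives over the image of the identity element, which therefore
    has to be identified with \<open>q\<close>.\<close>
  have "Gact S ?one q = q"
    using q by (simp flip: group_action.id_eq_one[OF act(1)])
  moreover have "\<xi> i \<in> tangent_space (Gatlas S) ?one"
    using assms(1) unfolding lie_algebra_basis_def by (metis fn.span_base rangeI)
  ultimately show ?thesis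
    using pushforward_tangent[OF chaplygin_manifolds(2,1)
        smooth_map_orbit_map[OF chaplygin_manifolds(2,1) act(2) q]]
    unfolding inf_gen_def by metis
qed

section \<open>The frame at a point of Q over a chart of Q/G\<close>

context
  fixes U \<phi> q
  assumes U: "(U, \<phi>) \<in> Batlas S" and q: "q \<in> points (Qatlas S)" "bproj S q \<in> U"
begin

lemma Xh_distr: "Xh S (U, \<phi>) a q \<in> distr S q"
  and pushforward_Xh: "pushforward (Batlas S) (bproj S) q (Xh S (U, \<phi>) a q)
    = coord_field S (U, \<phi>) a (bproj S q)"
  using horizontal_lift[OF q(1) coord_deriv_tangent[OF U q(2)]]
  by (simp_all add: Xh_def coord_field_def)

lemma Xh_tangent: "Xh S (U, \<phi>) a q \<in> tangent_space (Qatlas S) q"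
  using distr_tangent[OF q(1) Xh_distr] .

lemma Gmat_sym: "Gmat S (U, \<phi>) q $ a $ b = Gmat S (U, \<phi>) q $ b $ a"
  using symmetric_tensorD(1)[OF chaplygin_metric(1) q(1) Xh_tangent Xh_tangent]
  by (simp add: Gmat_def)

text \<open>A Gram matrix of independent vectors is invertible. If \<open>c\<close> is in its
  kernel, the combination \<open>v\<close> of the \<open>?X a\<close> has length zero, so
  \<open>v = 0\<close> by definiteness; \<open>v\<close> projects to the coordinate vector with
  components \<open>c\<close>, hence \<open>c = 0\<close>.\<close>

lemma Gmat_inverse: "matrix_inv (Gmat S (U, \<phi>) q) ** Gmat S (U, \<phi>) q = mat 1"
proof -
  let ?G = "Gmat S (U, \<phi>) q" and ?X = "\<lambda>a. Xh S (U, \<phi>) a q"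
  note gsum = symmetric_tensor_sum[OF chaplygin_manifolds(1)
      chaplygin_metric(1) q(1) _ Xh_tangent finite]
  have "c = 0" if c: "?G *v c = 0" for c
  proof -
    define v where "v = (\<Sum>a\<in>UNIV. fscale (c $ a) (?X a))"
    have vT: "v \<in> tangent_space (Qatlas S) q"
      unfolding v_def
      by (intro fn.subspace_sum fn.subspace_scale Xh_tangent
          subspace_tangent_space[OF chaplygin_manifolds(1) q(1)])
    have "metric_g S q (?X a) v = (?G *v c) $ a" for a
      unfolding v_def gsum(2)[OF Xh_tangent]
      by (simp add: matrix_vector_mult_def Gmat_def mult.commute)
    then have "metric_g S q v v = 0"
      using gsum(1)[OF vT, of "\<lambda>a. c $ a" "\<lambda>a. a" UNIV] c by (simp flip: v_def)
    then have "v = 0" using chaplygin_metric(2)[OF q(1) vT] by force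
    then have "pushforward (Batlas S) (bproj S) q v = 0" by (simp add: pushforward_def fun_eq_iff)
    then have z: "coord_deriv (Batlas S) (U, \<phi>) (bproj S q) c = 0"
      by (simp add: v_def pushforward_linear pushforward_Xh coord_field_def
          coord_deriv_expand[OF U q(2), of c])
    have "c $ a = 0" for a
      using chart_component(2)[OF chaplygin_manifolds(3) U q(2), of c a] by (simp add: z)
    then show "c = 0" by (simp add: vec_eq_iff)
  qed
  then obtain B where "B ** ?G = mat 1" using matrix_left_invertible_ker by blast
  \<comment> \<open>\<open>matrix_inv\<close> chooses some two-sided inverse, so the existence of
    one has to be supplied.\<close>
  then have "\<exists>B. ?G ** B = mat 1 \<and> B ** ?G = mat 1"
    using matrix_left_right_inverse by blast
  from someI_ex[OF this] show ?thesis unfolding matrix_inv_def by blast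
qed

context
  fixes \<xi> :: "'k \<Rightarrow> 'h tvec"
  assumes \<xi>: "lie_algebra_basis S \<xi>"
begin

lemma Xp_tangent: "Xp S \<xi> (U, \<phi>) i q \<in> tangent_space (Qatlas S) q"
  unfolding Xp_def
  by (intro fn.subspace_add fn.subspace_sum fn.subspace_scale Xh_tangent inf_gen_tangent[OF \<xi> q(1)]
      subspace_tangent_space[OF chaplygin_manifolds(1) q(1)])

text \<open>\<open>Kcoeff\<close> is chosen for this purpose: contracting the inverse Gram matrix
  with the Gram matrix turns the correction into minus the product of \<open>Xh\<close> with the
  generator.\<close>

lemma Xp_orthogonal: "metric_g S q (Xh S (U, \<phi>) d q) (Xp S \<xi> (U, \<phi>) i q) = 0"
proof -
  let ?G = "Gmat S (U, \<phi>) q" and ?X = "\<lambda>a. Xh S (U, \<phi>) a q"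
  let ?v = "\<lambda>a. metric_g S q (?X a) (inf_gen S \<xi> i q)"
  note T = subspace_tangent_space[OF chaplygin_manifolds(1) q(1)]
  have "metric_g S q (?X d) (Xp S \<xi> (U, \<phi>) i q) =
      ?v d + (\<Sum>b\<in>UNIV. Kcoeff S \<xi> (U, \<phi>) b i q * metric_g S q (?X d) (?X b))"
    unfolding Xp_def
    by (subst symmetric_tensor_add_right[OF chaplygin_manifolds(1) chaplygin_metric(1) q(1)
          Xh_tangent inf_gen_tangent[OF \<xi> q(1)] fn.subspace_sum[OF T fn.subspace_scale[OF T Xh_tangent]]],
        subst symmetric_tensor_sum(2)[OF chaplygin_manifolds(1) chaplygin_metric(1) q(1)
          Xh_tangent Xh_tangent]) simp_all
  also have "(\<Sum>b\<in>UNIV. Kcoeff S \<xi> (U, \<phi>) b i q * metric_g S q (?X d) (?X b)) =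
      - (\<Sum>b\<in>UNIV. \<Sum>a\<in>UNIV. (matrix_inv ?G $ a $ b * ?G $ b $ d) * ?v a)"
    using Gmat_sym[of d]
    by (simp add: Kcoeff_def sum_distrib_left sum_distrib_right Gmat_def sum_negf algebra_simps)
  also have "(\<Sum>b\<in>UNIV. \<Sum>a\<in>UNIV. (matrix_inv ?G $ a $ b * ?G $ b $ d) * ?v a) =
      (\<Sum>a\<in>UNIV. (matrix_inv ?G ** ?G) $ a $ d * ?v a)"
    by (subst sum.swap) (simp add: matrix_matrix_mult_def sum_distrib_right)
  also have "\<dots> = (\<Sum>a\<in>UNIV. if a = d then ?v a else 0)"
    unfolding Gmat_inverse by (intro sum.cong) (auto simp: mat_def)
  finally show ?thesis by simp
qed

text \<open>The vector \<open>R\<^sup>k\<^sub>b\<^sub>c X\<^sub>k\<close> is the part of \<open>[X\<^sub>b, X\<^sub>c]\<close> orthogonal to the distribution. It is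
  therefore skew in \<open>b\<close>, \<open>c\<close>, whether or not the \<open>X\<^sub>k\<close> are known to be linearly independent.\<close>

lemma bracket_coefficients_skew:
  assumes R: "bracket_coefficients S \<xi> Rh R"
  shows "(\<Sum>k\<in>UNIV. fscale (R (U, \<phi>) k b c q + R (U, \<phi>) k c b q) (Xp S \<xi> (U, \<phi>) k q)) = 0"
    (is "?w = 0")
proof -
  let ?X = "\<lambda>a. Xh S (U, \<phi>) a q" and ?Y = "\<lambda>k. Xp S \<xi> (U, \<phi>) k q"
  let ?u = "\<Sum>d\<in>UNIV. fscale (Rh (U, \<phi>) d b c q + Rh (U, \<phi>) d c b q) (?X d)"
  note T = subspace_tangent_space[OF chaplygin_manifolds(1) q(1)]
  have uT: "?u \<in> tangent_space (Qatlas S) q" and wT: "?w \<in> tangent_space (Qatlas S) q"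
    by (intro fn.subspace_sum fn.subspace_scale T Xh_tangent Xp_tangent)+
  have br: "lie_bracket (Qatlas S) (Xh S (U, \<phi>) a) (Xh S (U, \<phi>) b) q =
           (\<Sum>d\<in>UNIV. fscale (Rh (U, \<phi>) d a b q) (?X d)) +
           (\<Sum>k\<in>UNIV. fscale (R (U, \<phi>) k a b q) (?Y k))" for a b
    using R U q unfolding bracket_coefficients_def by auto
  have "?u + ?w = lie_bracket (Qatlas S) (Xh S (U, \<phi>) b) (Xh S (U, \<phi>) c) q +
      lie_bracket (Qatlas S) (Xh S (U, \<phi>) c) (Xh S (U, \<phi>) b) q"
    unfolding br by (simp add: fn.scale_left_distrib sum.distrib algebra_simps)
  also have "\<dots> = 0" by (auto simp: lie_bracket_def fun_eq_iff)
  finally have uw: "?u + ?w = 0" .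
  \<comment> \<open>Pairing \<open>?u + ?w = 0\<close> with \<open>?w\<close> removes the horizontal
    \<open>?u\<close> and leaves the squared length of \<open>?w\<close>, so definiteness gives
    \<open>?w = 0\<close>.\<close>
  have "metric_g S q (?X d) ?w = 0" for d
    by (subst symmetric_tensor_sum(2)[OF chaplygin_manifolds(1) chaplygin_metric(1) q(1)
          Xh_tangent Xp_tangent]) (simp_all add: Xp_orthogonal)
  then have "metric_g S q ?u ?w = 0"
    by (subst symmetric_tensor_sum(1)[OF chaplygin_manifolds(1) chaplygin_metric(1) q(1)
          wT Xh_tangent]) simp_all
  moreover have "metric_g S q (?u + ?w) ?w = metric_g S q ?u ?w + metric_g S q ?w ?w"
    by (rule symmetric_tensorD(2)[OF chaplygin_metric(1) q(1) uT wT wT])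
  moreover have "metric_g S q 0 ?w = 0"
    using symmetric_tensorD(3)[OF chaplygin_metric(1) q(1) uT wT, of 0] by simp
  ultimately have "metric_g S q ?w ?w = 0" unfolding uw by simp
  then show ?thesis using chaplygin_metric(2)[OF q(1) wT] by fastforce
qed

text \<open>The modified tensor need be neither definite nor orthogonal on the frame. Skewness is
  obtained for vectors by means of the original metric and then passed through the linear map
  \<open>gbar q (Xh S (U, \<phi>) a q)\<close>.\<close>

lemma gbar_R_skew:
  assumes R: "bracket_coefficients S \<xi> Rh R" and gbar: "symmetric_tensor (Qatlas S) gbar"
  shows "(\<Sum>k\<in>UNIV. gbar q (Xh S (U, \<phi>) a q) (Xp S \<xi> (U, \<phi>) k q) * R (U, \<phi>) k b c q) =
    - (\<Sum>k\<in>UNIV. gbar q (Xh S (U, \<phi>) a q) (Xp S \<xi> (U, \<phi>) k q) * R (U, \<phi>) k c b q)"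
proof -
  have "(\<Sum>k\<in>UNIV. (R (U, \<phi>) k b c q + R (U, \<phi>) k c b q) *
      gbar q (Xh S (U, \<phi>) a q) (Xp S \<xi> (U, \<phi>) k q)) = gbar q (Xh S (U, \<phi>) a q)
        (\<Sum>k\<in>UNIV. fscale (R (U, \<phi>) k b c q + R (U, \<phi>) k c b q) (Xp S \<xi> (U, \<phi>) k q))"
    by (rule symmetric_tensor_sum(2)[OF chaplygin_manifolds(1) gbar q(1) Xh_tangent Xp_tangent
          finite, symmetric])
  also have "\<dots> = gbar q (Xh S (U, \<phi>) a q) 0"
    by (simp only: bracket_coefficients_skew[OF R])
  also have "\<dots> = 0"
    using symmetric_tensor_sum(2)[OF chaplygin_manifolds(1) gbar q(1) Xh_tangent, of "{}"] by simp
  finally show ?thesis by (simp add: algebra_simps sum.distrib eq_neg_iff_add_eq_0)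
qed

end

end

section \<open>Passage from Q to Q/G\<close>

text \<open>\<open>descend\<close> evaluates at this chosen element. Because the orbits partition Q,
  it is a point of Q lying over \<open>p\<close>, and identities proved at such points hold for the
  functions on Q/G.\<close>

lemma bproj_representative:
  assumes "p \<in> points (Batlas S)"
  shows "(SOME q. q \<in> p) \<in> points (Qatlas S)" "bproj S (SOME q. q \<in> p) = p"
proof -
  let ?q = "SOME q. q \<in> p" and ?orbs = "orbits (Ggroup S) (points (Qatlas S)) (Gact S)"
  have "smooth_action (Ggroup S) (Gatlas S) (Qatlas S) (Gact S)"
    using S unfolding chaplygin_system_def by (elim conjE)
  then interpret group_action "Ggroup S" "points (Qatlas S)" "Gact S"
    unfolding smooth_action_def by (rule conjunct1)
  have "orbit_manifold (Ggroup S) (Qatlas S) (Gact S) (Batlas S)"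
    using S unfolding chaplygin_system_def by (elim conjE)
  then have "points (Batlas S) = ?orbs"
    unfolding orbit_manifold_def by (elim conjE)
  then have p: "p \<in> ?orbs" using assms by simp
  then obtain x where "x \<in> points (Qatlas S)" "p = orbit (Ggroup S) (Gact S) x"
    unfolding orbits_def by (elim CollectE exE conjE)
  then have "x \<in> p" using orbit_refl by simp
  then have q: "?q \<in> p" by (rule someI)
  then have "?q \<in> \<Union>?orbs" using p by (rule UnionI[rotated])
  then show Q: "?q \<in> points (Qatlas S)" by (simp only: orbits_coverture)
  have "bproj S ?q \<in> ?orbs"
    unfolding bproj_def orbits_def using Q by (intro CollectI exI conjI) simp_all
  moreover have "?q \<in> bproj S ?q" unfolding bproj_def by (rule orbit_refl[OF Q])
  ultimately show "bproj S ?q = p"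
    using disjoint_union[OF _ p] q by (metis disjoint_iff)
qed

lemma gR_skew:
  assumes "(U, \<phi>) \<in> Batlas S" "p \<in> U" "lie_algebra_basis S \<xi>" "bracket_coefficients S \<xi> Rh R"
    "symmetric_tensor (Qatlas S) gbar"
  shows "gR S gbar \<xi> R (U, \<phi>) a b c p = - gR S gbar \<xi> R (U, \<phi>) a c b p"
proof -
  have "p \<in> points (Batlas S)" using pointsI[OF assms(1,2)] .
  note q = bproj_representative[OF this]
  have "bproj S (SOME q. q \<in> p) \<in> U" using assms(2) by (simp only: q(2))
  from gbar_R_skew[OF assms(1) q(1) this assms(3-5)] show ?thesis
    unfolding gR_def descend_def .
qed

lemma g_base_sym:
  assumes "(U, \<phi>) \<in> Batlas S" "p \<in> U"
  shows "g_base S (U, \<phi>) a b p = g_base S (U, \<phi>) b a p"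
proof -
  have "p \<in> points (Batlas S)" using pointsI[OF assms] .
  note q = bproj_representative[OF this]
  have "bproj S (SOME q. q \<in> p) \<in> U" using assms(2) by (simp only: q(2))
  from Gmat_sym[OF assms(1) q(1) this] show ?thesis
    unfolding g_base_def descend_def .
qed

end

section \<open>The pointwise equivalence\<close>

lemma condition_A'_iff_skew:
  fixes T g :: "'m \<Rightarrow> _"
  assumes T: "\<And>a b c. T a b c = - T a c b" and g: "\<And>a b. g a b = g b a"
  shows "(\<forall>a b c. T b a c + T a b c - g b c * F a - g a c * F b + 2 * g a b * F c = (0::real)) \<longleftrightarrow>
    (\<forall>a b c. 1 / 6 * (T b a c - T c a b + 2 * T a b c) = (g a c * F b - g a b * F c) / 2)"
    (is "(\<forall>a b c. ?A a b c = 0) \<longleftrightarrow> (\<forall>a b c. ?B a b c = ?C a b c)")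
proof
  assume A: "\<forall>a b c. ?A a b c = 0"
  show "\<forall>a b c. ?B a b c = ?C a b c"
  proof (intro allI)
    fix a b c
    \<comment> \<open>By the symmetries of \<open>T\<close> and \<open>g\<close>, this difference
      equals \<open>6 * (?B a b c - ?C a b c)\<close>.\<close>
    have "?A a b c - ?A a c b = 0" using A by simp
    then show "?B a b c = ?C a b c" using T[of a b c] g[of b c] by (simp add: field_simps)
  qed
next
  assume B: "\<forall>a b c. ?B a b c = ?C a b c"
  show "\<forall>a b c. ?A a b c = 0"
  proof (intro allI)
    fix a b c
    \<comment> \<open>The terms \<open>T c a b\<close> and \<open>T c b a\<close> cancel by
      skewness; twice the difference of the two sides is \<open>?A a b c\<close>.\<close>
    have "?B a b c + ?B b a c = ?C a b c + ?C b a c" by (simp only: B[rule_format])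
    then show "?A a b c = 0" using T[of c a b] g[of a b] by (simp add: field_simps)
  qed
qed

text \<open>Here \<open>v\<close> stands for the velocities and \<open>u\<close>, \<open>w\<close>
  for the components of two tangent vectors. Summing over all ordered pairs \<open>b\<close>,
  \<open>c\<close> determines only the skew part of a coefficient array, so the skew
  \<open>\<gamma>\<close> is compared with the skew part of \<open>g a c * F b\<close>; hence the
  factor one half.\<close>

lemma skew_coefficients_iff_forms:
  fixes \<gamma> :: "'m::finite \<Rightarrow> 'm \<Rightarrow> 'm \<Rightarrow> real"
  assumes skew: "\<And>a b c. \<gamma> b c a = - \<gamma> c b a"
  shows "(\<forall>a b c. \<gamma> b c a = (g a c * F b - g a b * F c) / 2) \<longleftrightarrow>
    (\<forall>v u w. (\<Sum>c\<in>UNIV. u c * F c) * (\<Sum>a\<in>UNIV. \<Sum>b\<in>UNIV. g a b * v a * w b)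
       - (\<Sum>c\<in>UNIV. w c * F c) * (\<Sum>a\<in>UNIV. \<Sum>b\<in>UNIV. g a b * v a * u b)
     = (\<Sum>a\<in>UNIV. \<Sum>b\<in>UNIV. \<Sum>c\<in>UNIV. \<gamma> b c a * v a * (u b * w c - w b * u c)))"
    (is "?L \<longleftrightarrow> (\<forall>v u w. ?E v u w = ?F v u w)")
proof
  assume L: ?L
  show "\<forall>v u w. ?E v u w = ?F v u w"
  proof (intro allI)
    fix v u w :: "'m \<Rightarrow> real"
    have prod: "(\<Sum>c\<in>UNIV. x c * F c) * (\<Sum>a\<in>UNIV. \<Sum>b\<in>UNIV. g a b * v a * y b) =
        (\<Sum>a\<in>UNIV. \<Sum>b\<in>UNIV. \<Sum>c\<in>UNIV. g a c * F b * v a * (x b * y c))" for x y :: "'m \<Rightarrow> real"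
    proof -
      have "(\<Sum>c\<in>UNIV. x c * F c) * (\<Sum>a\<in>UNIV. \<Sum>b\<in>UNIV. g a b * v a * y b) =
          (\<Sum>a\<in>UNIV. (\<Sum>b\<in>UNIV. x b * F b) * (\<Sum>c\<in>UNIV. g a c * v a * y c))"
        by (simp add: sum_distrib_left)
      also have "\<dots> = (\<Sum>a\<in>UNIV. \<Sum>b\<in>UNIV. \<Sum>c\<in>UNIV. g a c * F b * v a * (x b * y c))"
        by (simp add: sum_product mult_ac)
      finally show ?thesis .
    qed
    let ?W = "\<lambda>b c. u b * w c - w b * u c"
    have "?E v u w = (\<Sum>a\<in>UNIV. \<Sum>b\<in>UNIV. \<Sum>c\<in>UNIV. g a c * F b * v a * ?W b c)"
      unfolding prod by (simp add: sum_subtractf[symmetric] right_diff_distrib)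
    also have "\<dots> = ?F v u w"
    proof (rule sum.cong[OF refl])
      fix a
      let ?h = "\<lambda>b c. g a c * F b * v a * ?W b c"
      have "(\<Sum>b\<in>UNIV. \<Sum>c\<in>UNIV. ?h b c) =
          (\<Sum>b\<in>UNIV. \<Sum>c\<in>UNIV. ?h b c / 2) + (\<Sum>b\<in>UNIV. \<Sum>c\<in>UNIV. ?h b c / 2)"
        by (simp only: sum.distrib[symmetric] field_sum_of_halves)
      \<comment> \<open>Exchanging \<open>b\<close> and \<open>c\<close> in one half of the sum
        antisymmetrises the coefficient, since \<open>?W\<close> changes sign.\<close>
      also have "(\<Sum>b\<in>UNIV. \<Sum>c\<in>UNIV. ?h b c / 2) + (\<Sum>b\<in>UNIV. \<Sum>c\<in>UNIV. ?h b c / 2) =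
          (\<Sum>b\<in>UNIV. \<Sum>c\<in>UNIV. ?h b c / 2) + (\<Sum>b\<in>UNIV. \<Sum>c\<in>UNIV. ?h c b / 2)"
        by (subst (2) sum.swap) (rule refl)
      also have "\<dots> = (\<Sum>b\<in>UNIV. \<Sum>c\<in>UNIV. ?h b c / 2 + ?h c b / 2)"
        by (simp add: sum.distrib)
      also have "\<dots> = (\<Sum>b\<in>UNIV. \<Sum>c\<in>UNIV. \<gamma> b c a * v a * ?W b c)"
        by (intro sum.cong refl) (simp add: L[rule_format] field_simps)
      finally show "(\<Sum>b\<in>UNIV. \<Sum>c\<in>UNIV. ?h b c) = (\<Sum>b\<in>UNIV. \<Sum>c\<in>UNIV. \<gamma> b c a * v a * ?W b c)" .
    qed
    finally show "?E v u w = ?F v u w" .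
  qed
next
  assume R: "\<forall>v u w. ?E v u w = ?F v u w"
  \<comment> \<open>Unit vectors isolate single coefficients: the right side becomes
    \<open>\<gamma> b c a - \<gamma> c b a\<close>, which is twice
    \<open>\<gamma> b c a\<close>.\<close>
  define \<delta> where "\<delta> a b = (if b = a then 1 else 0 :: real)" for a b :: 'm
  have \<delta>1: "(\<Sum>b\<in>UNIV. \<delta> a b * f b) = f a" for a f
    unfolding \<delta>_def by (simp add: if_distrib[of "\<lambda>x. x * _"] cong: if_cong)
  then have \<delta>2: "(\<Sum>b\<in>UNIV. f b * \<delta> a b) = f a" for a f by (simp add: mult.commute)
  show ?L
  proof (intro allI)
    fix a b c
    have G: "(\<Sum>x\<in>UNIV. \<Sum>y\<in>UNIV. g x y * \<delta> a x * \<delta> d y) = g a d" for d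
      by (simp add: \<delta>2)
    have "(\<Sum>y\<in>UNIV. \<Sum>z\<in>UNIV. \<gamma> y z x * \<delta> a x * (\<delta> b y * \<delta> c z - \<delta> c y * \<delta> b z)) =
        (\<gamma> b c x - \<gamma> c b x) * \<delta> a x" for x
    proof -
      have "(\<Sum>y\<in>UNIV. \<Sum>z\<in>UNIV. \<gamma> y z x * \<delta> a x * (\<delta> b y * \<delta> c z - \<delta> c y * \<delta> b z)) =
          (\<Sum>y\<in>UNIV. (\<Sum>z\<in>UNIV. (\<gamma> y z x * \<delta> a x * \<delta> b y) * \<delta> c z)
            - (\<Sum>z\<in>UNIV. (\<gamma> y z x * \<delta> a x * \<delta> c y) * \<delta> b z))"
        by (simp add: sum_subtractf[symmetric] algebra_simps)
      also have "\<dots> = (\<gamma> b c x - \<gamma> c b x) * \<delta> a x"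
        unfolding \<delta>2 by (simp add: sum_subtractf \<delta>2 left_diff_distrib)
      finally show ?thesis .
    qed
    then have "?F (\<delta> a) (\<delta> b) (\<delta> c) = \<gamma> b c a - \<gamma> c b a" by (simp add: \<delta>2)
    moreover have "?E (\<delta> a) (\<delta> b) (\<delta> c) = F b * g a c - F c * g a b" by (simp add: G \<delta>1)
    ultimately have "F b * g a c - F c * g a b = \<gamma> b c a - \<gamma> c b a" using R by metis
    then show "\<gamma> b c a = (g a c * F b - g a b * F c) / 2"
      using skew[of b c a] by (simp add: field_simps)
  qed
qed

section \<open>Evaluation of the two forms on T(Q/G), and the equivalence\<close>

text \<open>Both forms involve only differentials of functions pulled back from Q/G, namely
  \<open>f\<close> and the coordinates. Hence \<open>u'\<close> and \<open>w'\<close> enter through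
  their projections \<open>u\<close> and \<open>w\<close>, whose components are read off by
  \<open>x\<close>.\<close>

lemma semibasic_forms_in_chart:
  fixes S :: "('q, 'n::finite, 'h, 'k::finite, 'm::finite) chaplygin"
  assumes S: "chaplygin_system S" and U: "(U, \<phi>) \<in> Batlas S" "p \<in> U"
    and f: "smooth_near (Batlas S) p f"
    and u: "u \<in> tangent_space (Batlas S) p"
      "\<And>h. smooth_near (Batlas S) p h \<Longrightarrow> u' (h \<circ> fst) = u h"
    and w: "w \<in> tangent_space (Batlas S) p"
      "\<And>h. smooth_near (Batlas S) p h \<Longrightarrow> w' (h \<circ> fst) = w h"
  defines "x \<equiv> \<lambda>v a. v (\<lambda>r. \<phi> r $ a)"
  shows "wedge (differential (f \<circ> fst)) (theta_l S (U, \<phi>)) (p, v) u' w' =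
      (\<Sum>c\<in>UNIV. x u c * coord_field S (U, \<phi>) c p f) *
        (\<Sum>a\<in>UNIV. \<Sum>b\<in>UNIV. g_base S (U, \<phi>) a b p * x v a * x w b)
      - (\<Sum>c\<in>UNIV. x w c * coord_field S (U, \<phi>) c p f) *
        (\<Sum>a\<in>UNIV. \<Sum>b\<in>UNIV. g_base S (U, \<phi>) a b p * x v a * x u b)"
    and "gamma_form S gbar \<xi> R (U, \<phi>) (p, v) u' w' = (\<Sum>a\<in>UNIV. \<Sum>b\<in>UNIV. \<Sum>c\<in>UNIV.
      gamma_coeff S gbar \<xi> R (U, \<phi>) b c a p * x v a * (x u b * x w c - x w b * x u c))"
proof -
  note B = chaplygin_manifolds(3)[OF S]
  have df: "y' (f \<circ> fst) = (\<Sum>c\<in>UNIV. x y c * coord_field S (U, \<phi>) c p f)"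
    and dq: "dq (U, \<phi>) a (p, v) y' = x y a"
    if y: "y \<in> tangent_space (Batlas S) p"
      "\<And>h. smooth_near (Batlas S) p h \<Longrightarrow> y' (h \<circ> fst) = y h" for y y' a
  proof -
    obtain e where e: "y = coord_deriv (Batlas S) (U, \<phi>) p e"
      using y(1) unfolding tangent_space_chart[OF B U] by blast
    have "x y c = e $ c" for c
      unfolding x_def e by (rule chart_component(2)[OF B U])
    moreover have "y f = (\<Sum>c\<in>UNIV. e $ c * coord_deriv (Batlas S) (U, \<phi>) p (axis c 1) f)"
      by (subst e, subst coord_deriv_expand[OF U]) (rule fscale_sum_apply)
    ultimately show "y' (f \<circ> fst) = (\<Sum>c\<in>UNIV. x y c * coord_field S (U, \<phi>) c p f)"
      using y(2)[OF f] by (simp add: coord_field_def)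
    show "dq (U, \<phi>) a (p, v) y' = x y a"
      using y(2)[OF chart_component(1)[OF B U], of a] by (simp add: dq_def differential_def x_def o_def)
  qed
  show "wedge (differential (f \<circ> fst)) (theta_l S (U, \<phi>)) (p, v) u' w' =
      (\<Sum>c\<in>UNIV. x u c * coord_field S (U, \<phi>) c p f) *
        (\<Sum>a\<in>UNIV. \<Sum>b\<in>UNIV. g_base S (U, \<phi>) a b p * x v a * x w b)
      - (\<Sum>c\<in>UNIV. x w c * coord_field S (U, \<phi>) c p f) *
        (\<Sum>a\<in>UNIV. \<Sum>b\<in>UNIV. g_base S (U, \<phi>) a b p * x v a * x u b)"
    unfolding wedge_def theta_l_def differential_def
    by (simp add: qdot_def x_def df[where y = u and y' = u', OF u]
      df[where y = w and y' = w', OF w] dq[where y = u and y' = u', OF u]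
      dq[where y = w and y' = w', OF w])
  show "gamma_form S gbar \<xi> R (U, \<phi>) (p, v) u' w' = (\<Sum>a\<in>UNIV. \<Sum>b\<in>UNIV. \<Sum>c\<in>UNIV.
      gamma_coeff S gbar \<xi> R (U, \<phi>) b c a p * x v a * (x u b * x w c - x w b * x u c))"
    unfolding gamma_form_def wedge_def
    by (simp add: qdot_def x_def dq[where y = u and y' = u', OF u]
      dq[where y = w and y' = w', OF w])
qed

theorem proposition6:
  fixes S :: "('q, 'n::finite, 'h, 'k::finite, 'm::finite) chaplygin"
    and gbar :: "'q tensor2"
    and \<xi> :: "'k \<Rightarrow> 'h tvec"
    and Rh :: "('q set, real^'m) chart \<Rightarrow> 'm \<Rightarrow> 'm \<Rightarrow> 'm \<Rightarrow> 'q \<Rightarrow> real"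
    and R :: "('q set, real^'m) chart \<Rightarrow> 'k \<Rightarrow> 'm \<Rightarrow> 'm \<Rightarrow> 'q \<Rightarrow> real"
    and f :: "'q set \<Rightarrow> real"
  assumes "chaplygin_system S"
    and "D_preserving_modification S gbar"
    and "invariant_tensor (Ggroup S) (Qatlas S) (Gact S) gbar"
    and "lie_algebra_basis S \<xi>"
    and "bracket_coefficients S \<xi> Rh R"
    and "smooth_fun_on (Batlas S) (points (Batlas S)) f"
  shows "condition_A' S gbar \<xi> R f \<longleftrightarrow> condition_gamma S gbar \<xi> R f"
proof -
  let ?B = "Batlas S" and ?TB = "tangent_atlas (Batlas S)"
  note S = assms(1) and B = chaplygin_manifolds(3)[OF assms(1)]
  have gbar: "symmetric_tensor (Qatlas S) gbar"
    using assms(2) unfolding D_preserving_modification_def by blast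
  let ?eq = "\<lambda>\<kappa> z u v. wedge (differential (f \<circ> fst)) (theta_l S \<kappa>) z u v = gamma_form S gbar \<xi> R \<kappa> z u v"
  \<comment> \<open>Both conditions quantify over charts and base points, so the equivalence is
    established for one chart and one \<open>p\<close>.\<close>
  have pointwise: "(\<forall>a b c. gR S gbar \<xi> R (U, \<phi>) b a c p + gR S gbar \<xi> R (U, \<phi>) a b c p
        - g_base S (U, \<phi>) b c p * coord_field S (U, \<phi>) a p f
        - g_base S (U, \<phi>) a c p * coord_field S (U, \<phi>) b p f
        + 2 * g_base S (U, \<phi>) a b p * coord_field S (U, \<phi>) c p f = 0) \<longleftrightarrow>
      (\<forall>v\<in>tangent_space ?B p. \<forall>u'\<in>tangent_space ?TB (p, v). \<forall>w'\<in>tangent_space ?TB (p, v).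
        ?eq (U, \<phi>) (p, v) u' w')" (is "?A \<longleftrightarrow> ?C")
    if U: "(U, \<phi>) \<in> ?B" "p \<in> U" for U \<phi> p
  proof -
    let ?F = "\<lambda>a. coord_field S (U, \<phi>) a p f" and ?g = "\<lambda>a b. g_base S (U, \<phi>) a b p"
    let ?\<gamma> = "\<lambda>b c a. gamma_coeff S gbar \<xi> R (U, \<phi>) b c a p"
    let ?x = "\<lambda>v a. v (\<lambda>r. \<phi> r $ a)"
    let ?alg = "\<lambda>v u w. (\<Sum>c\<in>UNIV. u c * ?F c) * (\<Sum>a\<in>UNIV. \<Sum>b\<in>UNIV. ?g a b * v a * w b)
       - (\<Sum>c\<in>UNIV. w c * ?F c) * (\<Sum>a\<in>UNIV. \<Sum>b\<in>UNIV. ?g a b * v a * u b)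
     = (\<Sum>a\<in>UNIV. \<Sum>b\<in>UNIV. \<Sum>c\<in>UNIV. ?\<gamma> b c a * v a * (u b * w c - w b * u c))"
    have "p \<in> points ?B" by (rule pointsI[OF U])
    then have f: "smooth_near ?B p f" using assms(6) unfolding smooth_fun_on_def by blast
    note forms = semibasic_forms_in_chart[OF S U f]
    have skew: "gR S gbar \<xi> R (U, \<phi>) a b c p = - gR S gbar \<xi> R (U, \<phi>) a c b p" for a b c
      by (rule gR_skew[OF S U assms(4,5) gbar])
    have sym: "?g a b = ?g b a" for a b by (rule g_base_sym[OF S U])
    have "?A \<longleftrightarrow> (\<forall>a b c. ?\<gamma> b c a = (?g a c * ?F b - ?g a b * ?F c) / 2)"
      unfolding gamma_coeff_def by (rule condition_A'_iff_skew[OF skew sym])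
    also have "\<dots> \<longleftrightarrow> (\<forall>v u w. ?alg v u w)"
    proof (rule skew_coefficients_iff_forms)
      fix a b c
      show "?\<gamma> b c a = - ?\<gamma> c b a"
        unfolding gamma_coeff_def skew[of a b c] by (simp add: algebra_simps)
    qed
    also have "\<dots> \<longleftrightarrow> ?C"
    proof
      assume alg: "\<forall>v u w. ?alg v u w"
      show ?C
      proof (intro ballI)
        fix v u' w' assume v: "v \<in> tangent_space ?B p"
          and u': "u' \<in> tangent_space ?TB (p, v)" and w': "w' \<in> tangent_space ?TB (p, v)"
        obtain u where u: "u \<in> tangent_space ?B p" "\<And>h. smooth_near ?B p h \<Longrightarrow> u' (h \<circ> fst) = u h"
          using tangent_bundle_vector_fst[OF B v u'] by blast
        obtain w where w: "w \<in> tangent_space ?B p" "\<And>h. smooth_near ?B p h \<Longrightarrow> w' (h \<circ> fst) = w h"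
          using tangent_bundle_vector_fst[OF B v w'] by blast
        show "?eq (U, \<phi>) (p, v) u' w'"
          using alg[rule_format, of "?x u" "?x v" "?x w"]
          by (simp only: forms(1)[OF u w] forms(2)[OF u w])
      qed
    next
      assume C: ?C
      show "\<forall>v u w. ?alg v u w"
      proof (intro allI)
        fix v u w :: "'m \<Rightarrow> real"
        \<comment> \<open>\<open>?V y\<close> is the tangent vector with prescribed components
          \<open>y\<close>. Taking \<open>?V v\<close> as the velocity and lifting
          \<open>?V u\<close> and \<open>?V w\<close> realises an arbitrary triple.\<close>
        let ?V = "\<lambda>y. coord_deriv ?B (U, \<phi>) p (\<chi> a. y a)"
        have V: "?V y \<in> tangent_space ?B p" for y by (rule coord_deriv_tangent[OF U])
        have x: "?V y (\<lambda>r. \<phi> r $ a) = y a" for y a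
          by (simp add: chart_component(2)[OF B U])
        obtain u' where u': "u' \<in> tangent_space ?TB (p, ?V v)"
          "\<And>h. smooth_near ?B p h \<Longrightarrow> u' (h \<circ> fst) = ?V u h"
          using tangent_bundle_vector_lift[OF B V V] by blast
        obtain w' where w': "w' \<in> tangent_space ?TB (p, ?V v)"
          "\<And>h. smooth_near ?B p h \<Longrightarrow> w' (h \<circ> fst) = ?V w h"
          using tangent_bundle_vector_lift[OF B V V] by blast
        have "?eq (U, \<phi>) (p, ?V v) u' w'" using C V u'(1) w'(1) by blast
        then have "?alg (?x (?V v)) (?x (?V u)) (?x (?V w))"
          by (simp only: forms(1)[OF V u'(2) V w'(2)] forms(2)[OF V u'(2) V w'(2)])
        then show "?alg v u w" unfolding x .
      qed
    qed
    finally show ?thesis .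
  qed
  \<comment> \<open>Quantification over points of the tangent bundle is split into base point and
    velocity, to match the pointwise statement.\<close>
  have "condition_gamma S gbar \<xi> R f \<longleftrightarrow> (\<forall>(U, \<phi>)\<in>?B. \<forall>p\<in>U.
      \<forall>v\<in>tangent_space ?B p. \<forall>u'\<in>tangent_space ?TB (p, v). \<forall>w'\<in>tangent_space ?TB (p, v).
        ?eq (U, \<phi>) (p, v) u' w')"
  proof -
    have "points ?TB = {(p, v). p \<in> points ?B \<and> v \<in> tangent_space ?B p}"
      unfolding points_def tangent_atlas_def by auto
    then show ?thesis
      unfolding condition_gamma_def by (fastforce intro: pointsI)
  qed
  also have "\<dots> \<longleftrightarrow> condition_A' S gbar \<xi> R f"
    unfolding condition_A'_def using pointwise by fastforce
  finally show ?thesis by blast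
qed

end
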